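(* Let $(X,\mathcal{F},\mu)$ be a probability space and let $S_n : \mathcal{M}(X) \to \mathcal{M}(X)$, $n \in \mathbb{N}$, be linear operators that are $L^2(\mu)$-contractions, i.e. $\|S_n f\|_{L^2(\mu)} \le \|f\|_{L^2(\mu)}$ for all $n$ and all $f \in L^2(\mu)$. Assume that $(S_n)$ commutes with a Bourgain sequence $(T_j)_{j \in \mathbb{N}}$ on $(X,\mathcal{F},\mu)$, i.e. $S_n T_j = T_j S_n$ for all $n, j$. Suppose that $S_n f$ converges $\mu$-almost surely for every $f \in L^\infty(\mu)$. Then there exists a finite-valued function $C(\delta)$, $\delta > 0$, such that $$N_f(\delta) \le C(\delta) \quad \text{for all } \delta > 0 \text{ and all } f \in L^2(\mu) \text{ with } \|f\|_{L^2(\mu)} \le 1.$$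
   Context: $(X,\mathcal{F},\mu)$ is a probability space; $\mathcal{M}(X)$ denotes the set of measurable functions $f : X \to \mathbb{R}$; $L^p(\mu)$ consists of real-valued functions only (the elements of $\mathcal{M}(X)$ with finite $L^p$-norm). Bourgain sequence: a sequence of linear operators $T_j : \mathcal{M}(X) \to \mathcal{M}(X)$, $j \in \mathbb{N}$, such that (1) each $T_j : L^1(\mu) \to L^1(\mu)$ is bounded; (2) each $T_j : L^2(\mu) \to L^2(\mu)$ is an isometry; (3) each $T_j$ is positive, i.e. $f \ge 0$ a.s. implies $T_j f \ge 0$ a.s.; (4) $T_j(1) = 1$, where $1$ is the constant function; (5) the mean ergodic condition holds: $\frac{1}{J}\sum_{j=1}^J T_j f \to \int_X f \, d\mu$ in $L^1(\mu)$-norm as $J \to \infty$, for all $f \in L^1(\mu)$. Entropy numbers: for a pseudo-metric space $(Y,d)$ ($d$ need not separate points), a subset $S \subset Y$ and $\delta>0$, $N(S,d,\delta)$ is the minimal number of closed $\delta$-balls in the pseudo-metric $d$ needed to cover $S$. For $f \in L^2(\mu)$ define a pseudo-metric on $\mathbb{N}$ by $d_f(n,n') = \|S_n f - S_{n'} f\|_{L^2(\mu)}$, and set $N_f(\delta) := N(\mathbb{N}, d_f, \delta)$, the $\delta$-entropy number of the set $\{S_n f : n \in \mathbb{N}\}$ in $L^2(\mu)$. *)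

theory Defs
  imports "HOL-Probability.Probability" "HOL-Library.Extended_Nat"
begin

text \<open>
  Operators on \<open>\<M>(X)\<close> are functions on all of \<^typ>\<open>'a \<Rightarrow> real\<close>, constrained only on
  \<open>borel_measurable M\<close>. Identities between measurable functions are read modulo null sets.
\<close>

definition L1_norm :: "'a measure \<Rightarrow> ('a \<Rightarrow> real) \<Rightarrow> real" where
  "L1_norm M f = (\<integral>x. \<bar>f x\<bar> \<partial>M)"

definition L2_norm :: "'a measure \<Rightarrow> ('a \<Rightarrow> real) \<Rightarrow> real" where
  "L2_norm M f = sqrt (\<integral>x. (f x)\<^sup>2 \<partial>M)"

definition L1_space :: "'a measure \<Rightarrow> ('a \<Rightarrow> real) set" where
  "L1_space M = {f. integrable M f}"

definition L2_space :: "'a measure \<Rightarrow> ('a \<Rightarrow> real) set" where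
  "L2_space M = {f \<in> borel_measurable M. integrable M (\<lambda>x. (f x)\<^sup>2)}"

definition Linfty_space :: "'a measure \<Rightarrow> ('a \<Rightarrow> real) set" where
  "Linfty_space M = {f \<in> borel_measurable M. esssup M (\<lambda>x. ereal \<bar>f x\<bar>) < \<infinity>}"

definition linear_operator :: "'a measure \<Rightarrow> (('a \<Rightarrow> real) \<Rightarrow> 'a \<Rightarrow> real) \<Rightarrow> bool" where
  "linear_operator M T \<longleftrightarrow>
     (\<forall>f \<in> borel_measurable M. T f \<in> borel_measurable M) \<and>
     (\<forall>f \<in> borel_measurable M. \<forall>g \<in> borel_measurable M.
        AE x in M. T (\<lambda>y. f y + g y) x = T f x + T g x) \<and>
     (\<forall>c. \<forall>f \<in> borel_measurable M. AE x in M. T (\<lambda>y. c * f y) x = c * T f x)"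

text \<open>
  Membership of \<open>T f\<close> in \<open>L\<^sup>1\<close> or \<open>L\<^sup>2\<close> has to be demanded explicitly, since the Bochner integral of a
  non-integrable function is \<open>0\<close>.
\<close>

definition L1_bounded :: "'a measure \<Rightarrow> (('a \<Rightarrow> real) \<Rightarrow> 'a \<Rightarrow> real) \<Rightarrow> bool" where
  "L1_bounded M T \<longleftrightarrow>
     (\<exists>K. \<forall>f \<in> L1_space M. T f \<in> L1_space M \<and> L1_norm M (T f) \<le> K * L1_norm M f)"

definition L2_isometry :: "'a measure \<Rightarrow> (('a \<Rightarrow> real) \<Rightarrow> 'a \<Rightarrow> real) \<Rightarrow> bool" where
  "L2_isometry M T \<longleftrightarrow>
     (\<forall>f \<in> L2_space M. T f \<in> L2_space M \<and> L2_norm M (T f) = L2_norm M f)"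

definition L2_contraction :: "'a measure \<Rightarrow> (('a \<Rightarrow> real) \<Rightarrow> 'a \<Rightarrow> real) \<Rightarrow> bool" where
  "L2_contraction M T \<longleftrightarrow>
     (\<forall>f \<in> L2_space M. T f \<in> L2_space M \<and> L2_norm M (T f) \<le> L2_norm M f)"

definition positive_operator :: "'a measure \<Rightarrow> (('a \<Rightarrow> real) \<Rightarrow> 'a \<Rightarrow> real) \<Rightarrow> bool" where
  "positive_operator M T \<longleftrightarrow>
     (\<forall>f \<in> borel_measurable M. (AE x in M. 0 \<le> f x) \<longrightarrow> (AE x in M. 0 \<le> T f x))"

text \<open>The sequence \<open>T\<^sub>1, T\<^sub>2, \<dots>\<close> is indexed from \<open>0\<close>, so its first \<open>J\<close> members are \<open>T j\<close> with \<open>j < J\<close>.\<close>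

definition mean_ergodic ::
    "'a measure \<Rightarrow> (nat \<Rightarrow> ('a \<Rightarrow> real) \<Rightarrow> 'a \<Rightarrow> real) \<Rightarrow> bool" where
  "mean_ergodic M T \<longleftrightarrow>
     (\<forall>f \<in> L1_space M.
        (\<lambda>J. L1_norm M (\<lambda>x. (1 / real J) * (\<Sum>j<J. T j f x) - (\<integral>y. f y \<partial>M))) \<longlonglongrightarrow> 0)"

definition bourgain_sequence ::
    "'a measure \<Rightarrow> (nat \<Rightarrow> ('a \<Rightarrow> real) \<Rightarrow> 'a \<Rightarrow> real) \<Rightarrow> bool" where
  "bourgain_sequence M T \<longleftrightarrow>
     (\<forall>j. linear_operator M (T j) \<and> L1_bounded M (T j) \<and> L2_isometry M (T j) \<and>
          positive_operator M (T j) \<and> (AE x in M. T j (\<lambda>_. 1) x = 1)) \<and>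
     mean_ergodic M T"

definition commuting_operators ::
    "'a measure \<Rightarrow> (('a \<Rightarrow> real) \<Rightarrow> 'a \<Rightarrow> real) \<Rightarrow> (('a \<Rightarrow> real) \<Rightarrow> 'a \<Rightarrow> real) \<Rightarrow> bool" where
  "commuting_operators M U V \<longleftrightarrow>
     (\<forall>f \<in> borel_measurable M. AE x in M. U (V f) x = V (U f) x)"

text \<open>
  The ambient pseudo-metric space is the whole type \<^typ>\<open>'b\<close>; the value is \<open>\<infinity>\<close> if no finite
  cover exists.
\<close>

definition entropy_number :: "'b set \<Rightarrow> ('b \<Rightarrow> 'b \<Rightarrow> real) \<Rightarrow> real \<Rightarrow> enat" where
  "entropy_number A d \<delta> =
     Inf {enat (card C) | C. finite C \<and> A \<subseteq> (\<Union>y\<in>C. {z. d y z \<le> \<delta>})}"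

definition orbit_dist ::
    "'a measure \<Rightarrow> (nat \<Rightarrow> ('a \<Rightarrow> real) \<Rightarrow> 'a \<Rightarrow> real) \<Rightarrow> ('a \<Rightarrow> real) \<Rightarrow> nat \<Rightarrow> nat \<Rightarrow> real" where
  "orbit_dist M S f n n' = L2_norm M (\<lambda>x. S n f x - S n' f x)"

definition orbit_entropy ::
    "'a measure \<Rightarrow> (nat \<Rightarrow> ('a \<Rightarrow> real) \<Rightarrow> 'a \<Rightarrow> real) \<Rightarrow> ('a \<Rightarrow> real) \<Rightarrow> real \<Rightarrow> enat" where
  "orbit_entropy M S f \<delta> = entropy_number UNIV (orbit_dist M S f) \<delta>"

end

theory Submission
  imports Defs "HOL-Library.Ramsey"
begin

text \<open>
  Suppose that, for arbitrarily large \<open>N\<close>, some \<open>f\<close> in the unit ball of \<open>L\<^sup>2\<close> has \<open>N\<close> values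
  \<open>S n f\<close> at mutual distance at least \<open>\<delta>\<close>. Truncation makes \<open>f\<close> bounded at the cost of a factor in
  \<open>\<delta>\<close>. The argument is Bourgain's: average \<open>f\<close> along the Bourgain sequence with random signs,
  \<open>F = J\<^bsup>-1/2\<^esup> \<Sum> e\<^sub>j T\<^sub>j f\<close>. Since the operators commute, \<open>S n F\<close> is the same random sum built on \<open>S n f\<close>.
  Each \<open>T\<^sub>j\<close> maps squares of bounded functions to squares, so by the mean ergodic theorem the variance
  of such a sum at almost every point is close to the squared \<open>L\<^sup>2\<close> norm of the function on
  which it is built. The family \<open>S n F\<close> therefore looks, at a typical point, like a Gaussian process
  with the covariance of the vectors \<open>S n f\<close>.

  Ramsey's theorem, applied to the inner products of the separated vectors, produces \<open>k\<close> pairs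
  whose normalised differences \<open>U i f = (S p f - S q f) / \<sigma>\<close> are nearly orthonormal
  (\<open>ramsey_small_cross_differences\<close>). At a typical point the maximum of \<open>U i F\<close> over \<open>i < k\<close> is then
  of the order \<open>sqrt (ln k)\<close> (\<open>sign_avg_max_large\<close>, a second moment argument for
  \<open>\<Sum> exp (L * U i F)\<close> with \<open>L = sqrt (ln k)\<close>). On the other hand \<open>F\<close> itself has subgaussian
  tails. If it is cut at height \<open>K = 4 L\<close>, the part above \<open>K\<close> is so small in \<open>L\<^sup>2\<close> that the sum of its
  \<open>k\<close> images is still negligible. The part below \<open>K\<close>, divided by \<open>K\<close>, is a function \<open>g\<close> with
  \<open>\<bar>g\<bar> \<le> 1\<close> and \<open>L\<^sup>2\<close> norm of the order \<open>1/L\<close>, while the maximum of \<open>\<bar>U i g\<bar>\<close> exceeds an absolute constant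
  with a probability bounded below by an absolute constant
  (\<open>near_orthonormal_images_large_maximum\<close>).

  This contradicts the maximal inequality \<open>maximal_function_small\<close>: almost sure convergence
  on bounded functions forces \<open>sup \<bar>S n g\<bar>\<close> to be small in probability when \<open>\<bar>g\<bar> \<le> 1\<close> and \<open>g\<close> is small
  in \<open>L\<^sup>2\<close>. It is an instance of the Banach principle, proved by a Baire category argument in the
  unit ball of \<open>L\<^sup>\<infinity>\<close> with the \<open>L\<^sup>2\<close> metric. Its smallness parameter depends on the \<open>S n\<close> and on
  \<open>\<delta>\<close> only, which is why the bound on \<open>N\<close> is uniform in \<open>f\<close>.
\<close>

section \<open>Square integrals and linear operators\<close>

text \<open>
  Estimates are stated for the squared norm: the inequality \<open>(a + b)\<^sup>2 \<le> 2 a\<^sup>2 + 2 b\<^sup>2\<close> takes the place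
  of the triangle inequality, at the price of constants that never matter.
\<close>

abbreviation sqnorm :: "'a measure \<Rightarrow> ('a \<Rightarrow> real) \<Rightarrow> real" where
  "sqnorm M f \<equiv> \<integral>x. (f x)\<^sup>2 \<partial>M"

lemma L2_space_measurable: "f \<in> L2_space M \<Longrightarrow> f \<in> borel_measurable M"
  by (simp add: L2_space_def)

lemma L2_space_integrable: "f \<in> L2_space M \<Longrightarrow> integrable M (\<lambda>x. (f x)\<^sup>2)"
  by (simp add: L2_space_def)

lemma L2_space_scale: "f \<in> L2_space M \<Longrightarrow> (\<lambda>x. c * f x) \<in> L2_space M"
  by (auto simp: L2_space_def power_mult_distrib)

lemma sqnorm_scale: "sqnorm M (\<lambda>x. c * f x) = c\<^sup>2 * sqnorm M f"
  by (simp add: power_mult_distrib)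

lemma sqnorm_nonneg: "0 \<le> sqnorm M f"
  by simp

lemma sum_square_le: "((a::real) + b)\<^sup>2 \<le> 2 * a\<^sup>2 + 2 * b\<^sup>2"
  using sum_squares_ge_zero[of "a - b" 0] by (simp add: power2_eq_square algebra_simps)

lemma L2_space_mult_integrable:
  assumes "f \<in> L2_space M" "g \<in> L2_space M"
  shows "integrable M (\<lambda>x. f x * g x)"
proof (rule Bochner_Integration.integrable_bound)
  show "integrable M (\<lambda>x. (f x)\<^sup>2 + (g x)\<^sup>2)"
    using assms by (auto simp: L2_space_def)
  show "(\<lambda>x. f x * g x) \<in> borel_measurable M"
    using assms by (auto simp: L2_space_def)
  show "AE x in M. norm (f x * g x) \<le> norm ((f x)\<^sup>2 + (g x)\<^sup>2)"
  proof (intro AE_I2)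
    fix x
    have "2 * (\<bar>f x\<bar> * \<bar>g x\<bar>) \<le> (f x)\<^sup>2 + (g x)\<^sup>2"
      using sum_squares_ge_zero[of "\<bar>f x\<bar> - \<bar>g x\<bar>" 0]
      by (simp add: power2_eq_square algebra_simps)
    moreover have "0 \<le> \<bar>f x\<bar> * \<bar>g x\<bar>" by (rule mult_nonneg_nonneg) simp_all
    ultimately have "\<bar>f x\<bar> * \<bar>g x\<bar> \<le> (f x)\<^sup>2 + (g x)\<^sup>2" by linarith
    then show "norm (f x * g x) \<le> norm ((f x)\<^sup>2 + (g x)\<^sup>2)"
      by (simp add: abs_mult)
  qed
qed

lemma L2_space_add:
  assumes "f \<in> L2_space M" "g \<in> L2_space M"
  shows "(\<lambda>x. f x + g x) \<in> L2_space M"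
proof -
  have "integrable M (\<lambda>x. (f x)\<^sup>2 + (g x)\<^sup>2 + 2 * (f x * g x))"
    using assms L2_space_mult_integrable[OF assms] by (auto simp: L2_space_def)
  then show ?thesis
    using assms by (auto simp: L2_space_def power2_sum mult.assoc)
qed

lemma L2_space_diff:
  assumes "f \<in> L2_space M" "g \<in> L2_space M"
  shows "(\<lambda>x. f x - g x) \<in> L2_space M"
  using L2_space_add[OF assms(1) L2_space_scale[OF assms(2), of "-1"]] by simp

lemma sqnorm_add_expand:
  assumes "f \<in> L2_space M" "g \<in> L2_space M"
  shows "sqnorm M (\<lambda>x. f x + g x) = sqnorm M f + sqnorm M g + 2 * (\<integral>x. f x * g x \<partial>M)"
proof -
  have "sqnorm M (\<lambda>x. f x + g x) = (\<integral>x. ((f x)\<^sup>2 + (g x)\<^sup>2) + 2 * (f x * g x) \<partial>M)"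
    by (simp add: power2_sum mult.assoc)
  also have "\<dots> = (\<integral>x. (f x)\<^sup>2 + (g x)\<^sup>2 \<partial>M) + (\<integral>x. 2 * (f x * g x) \<partial>M)"
    using assms L2_space_mult_integrable[OF assms]
    by (intro Bochner_Integration.integral_add) (auto simp: L2_space_def)
  also have "\<dots> = sqnorm M f + sqnorm M g + 2 * (\<integral>x. f x * g x \<partial>M)"
    using assms by (simp add: L2_space_def)
  finally show ?thesis .
qed

lemma sqnorm_add_le:
  assumes "f \<in> L2_space M" "g \<in> L2_space M"
  shows "sqnorm M (\<lambda>x. f x + g x) \<le> 2 * sqnorm M f + 2 * sqnorm M g"
proof -
  have "sqnorm M (\<lambda>x. f x + g x) \<le> (\<integral>x. 2 * (f x)\<^sup>2 + 2 * (g x)\<^sup>2 \<partial>M)"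
    using assms L2_space_add[OF assms] sum_square_le
    by (intro integral_mono) (auto simp: L2_space_def)
  also have "\<dots> = 2 * sqnorm M f + 2 * sqnorm M g"
    using assms by (simp add: L2_space_def)
  finally show ?thesis .
qed

lemma sqnorm_diff_le:
  assumes "f \<in> L2_space M" "g \<in> L2_space M"
  shows "sqnorm M (\<lambda>x. f x - g x) \<le> 2 * sqnorm M f + 2 * sqnorm M g"
  using sqnorm_add_le[OF assms(1) L2_space_scale[OF assms(2), of "-1"]] by simp

lemma sqnorm_triangle:
  assumes "f \<in> L2_space M" "g \<in> L2_space M" "h \<in> L2_space M"
  shows "sqnorm M (\<lambda>x. f x - h x) \<le>
    2 * sqnorm M (\<lambda>x. f x - g x) + 2 * sqnorm M (\<lambda>x. g x - h x)"
  using sqnorm_add_le[OF L2_space_diff[OF assms(1,2)] L2_space_diff[OF assms(2,3)]] by simp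

lemma L2_contraction_sqnorm:
  assumes "L2_contraction M T" "f \<in> L2_space M"
  shows "T f \<in> L2_space M" "sqnorm M (T f) \<le> sqnorm M f"
  using assms by (auto simp: L2_contraction_def L2_norm_def)

lemma L2_isometry_sqnorm:
  assumes "L2_isometry M T" "f \<in> L2_space M"
  shows "T f \<in> L2_space M" "sqnorm M (T f) = sqnorm M f"
  using assms by (auto simp: L2_isometry_def L2_norm_def)

lemma linear_operator_measurable:
  "linear_operator M T \<Longrightarrow> f \<in> borel_measurable M \<Longrightarrow> T f \<in> borel_measurable M"
  by (auto simp: linear_operator_def)

lemma linear_operator_add:
  assumes "linear_operator M T" "f \<in> borel_measurable M" "g \<in> borel_measurable M"
  shows "AE x in M. T (\<lambda>y. f y + g y) x = T f x + T g x"
  using assms by (auto simp: linear_operator_def)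

lemma linear_operator_scale:
  assumes "linear_operator M T" "f \<in> borel_measurable M"
  shows "AE x in M. T (\<lambda>y. c * f y) x = c * T f x"
  using assms by (auto simp: linear_operator_def)

lemma linear_operator_diff:
  assumes T: "linear_operator M T" and f: "f \<in> borel_measurable M" and g: "g \<in> borel_measurable M"
  shows "AE x in M. T (\<lambda>y. f y - g y) x = T f x - T g x"
proof -
  have "AE x in M. T (\<lambda>y. f y + (-1) * g y) x = T f x + T (\<lambda>y. (-1) * g y) x"
    using g by (intro linear_operator_add[OF T f]) simp
  moreover have "AE x in M. T (\<lambda>y. (-1) * g y) x = (-1) * T g x"
    by (rule linear_operator_scale[OF T g])
  ultimately show ?thesis by (auto simp: algebra_simps)
qed

lemma linear_operator_sum:
  fixes J :: nat
  assumes T: "linear_operator M T" and f: "\<And>j. f j \<in> borel_measurable M"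
  shows "AE x in M. T (\<lambda>y. \<Sum>j<J. c j * f j y) x = (\<Sum>j<J. c j * T (f j) x)"
proof (induction J)
  case 0
  have "AE x in M. T (\<lambda>y. 0 * (0::real)) x = 0 * T (\<lambda>y. 0) x"
    by (rule linear_operator_scale[OF T]) simp
  then show ?case by simp
next
  case (Suc J)
  have "AE x in M. T (\<lambda>y. (\<Sum>j<J. c j * f j y) + c J * f J y) x =
      T (\<lambda>y. \<Sum>j<J. c j * f j y) x + T (\<lambda>y. c J * f J y) x"
    using f by (intro linear_operator_add[OF T]) simp_all
  moreover have "AE x in M. T (\<lambda>y. c J * f J y) x = c J * T (f J) x"
    by (rule linear_operator_scale[OF T f])
  ultimately show ?case using Suc by auto
qed

context prob_space
begin

lemma bounded_in_L2_space:
  assumes "f \<in> borel_measurable M" "\<And>x. \<bar>f x\<bar> \<le> B"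
  shows "f \<in> L2_space M"
proof -
  have "(f x)\<^sup>2 \<le> B\<^sup>2" for x
    using assms(2)[of x] by (metis abs_le_square_iff abs_of_nonneg abs_ge_zero order_trans)
  then show ?thesis
    using assms(1) unfolding L2_space_def
    by (auto intro!: integrable_const_bound[of _ "B\<^sup>2"])
qed

lemma chebyshev_sqnorm:
  assumes f: "f \<in> L2_space M" and t: "t > 0"
  shows "prob {x\<in>space M. \<bar>f x\<bar> > t} \<le> sqnorm M f / t\<^sup>2"
proof -
  note [measurable] = L2_space_measurable[OF f]
  have "prob {x\<in>space M. \<bar>f x\<bar> > t} \<le> prob {x\<in>space M. (f x)\<^sup>2 \<ge> t\<^sup>2}"
  proof (rule finite_measure_mono)
    show "{x \<in> space M. t < \<bar>f x\<bar>} \<subseteq> {x \<in> space M. t\<^sup>2 \<le> (f x)\<^sup>2}"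
      using t by (auto simp: abs_le_square_iff[symmetric])
  qed simp
  also have "\<dots> \<le> sqnorm M f / t\<^sup>2"
    using t by (intro integral_Markov_inequality_measure[OF L2_space_integrable[OF f], of "space M"]) auto
  finally show ?thesis .
qed

lemma chebyshev_sqnorm_finite_family:
  assumes A: "finite A" and f: "\<And>n. n \<in> A \<Longrightarrow> f n \<in> L2_space M" and t: "t > 0"
  shows "prob {x\<in>space M. \<exists>n\<in>A. \<bar>f n x\<bar> > t} \<le> (\<Sum>n\<in>A. sqnorm M (f n)) / t\<^sup>2"
proof -
  have "{x\<in>space M. \<exists>n\<in>A. \<bar>f n x\<bar> > t} = (\<Union>n\<in>A. {x\<in>space M. \<bar>f n x\<bar> > t})"
    by auto
  then have "prob {x\<in>space M. \<exists>n\<in>A. \<bar>f n x\<bar> > t} \<le> (\<Sum>n\<in>A. prob {x\<in>space M. \<bar>f n x\<bar> > t})"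
    using A L2_space_measurable[OF f] by (auto intro!: finite_measure_subadditive_finite)
  also have "\<dots> \<le> (\<Sum>n\<in>A. sqnorm M (f n) / t\<^sup>2)"
    using f t by (intro sum_mono chebyshev_sqnorm)
  finally show ?thesis by (simp add: sum_divide_distrib)
qed

text \<open>
  For a fixed finite set of indices a maximal inequality is trivial, with a constant that grows with
  the number of indices. It disposes of finitely many indices at a time; convergence says nothing about those.
\<close>

lemma contraction_weak_bound:
  assumes A: "finite A" and S: "\<And>n. L2_contraction M (S n)" and d: "d \<in> L2_space M" and t: "t > 0"
  shows "prob {x\<in>space M. \<exists>n\<in>A. \<bar>S n d x\<bar> > t} \<le> real (card A) * sqnorm M d / t\<^sup>2"
proof -
  have "(\<Sum>n\<in>A. sqnorm M (S n d)) \<le> real (card A) * sqnorm M d"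
    by (rule sum_bounded_above) (rule L2_contraction_sqnorm[OF S d])
  then have "(\<Sum>n\<in>A. sqnorm M (S n d)) / t\<^sup>2 \<le> real (card A) * sqnorm M d / t\<^sup>2"
    by (rule divide_right_mono) simp
  with chebyshev_sqnorm_finite_family[OF A L2_contraction_sqnorm(1)[OF S d] t] show ?thesis
    by (rule order_trans)
qed

end

section \<open>A maximal inequality for small bounded functions\<close>

context prob_space
begin

text \<open>
  An oscillation over finitely many indices survives a small \<open>L\<^sup>2\<close> perturbation of the function, at
  the price of halving both thresholds. This is the openness needed in the category argument.
\<close>

lemma oscillation_stable:
  fixes S :: "nat \<Rightarrow> ('a \<Rightarrow> real) \<Rightarrow> 'a \<Rightarrow> real"
  assumes lin: "\<And>n. linear_operator M (S n)" and con: "\<And>n. L2_contraction M (S n)"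
    and c: "c > 0" and h: "h \<in> L2_space M"
    and osc: "prob {x\<in>space M. \<exists>n\<in>{N..m}. \<bar>S n h x - S N h x\<bar> > 2 * c} > 2 * c"
  shows "\<exists>\<rho>>0. \<forall>h'\<in>L2_space M. sqnorm M (\<lambda>x. h' x - h x) \<le> \<rho> \<longrightarrow>
    prob {x\<in>space M. \<exists>n\<in>{N..m}. \<bar>S n h' x - S N h' x\<bar> > c} \<ge> c"
proof -
  define \<rho> where "\<rho> = c ^ 3 / (4 * (real m + 1))"
  have \<rho>: "\<rho> > 0" using c by (simp add: \<rho>_def)
  have "prob {x\<in>space M. \<exists>n\<in>{N..m}. \<bar>S n h' x - S N h' x\<bar> > c} \<ge> c"
    if h': "h' \<in> L2_space M" and close: "sqnorm M (\<lambda>x. h' x - h x) \<le> \<rho>" for h'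
  proof -
    let ?d = "\<lambda>x. h' x - h x"
    have d: "?d \<in> L2_space M" by (rule L2_space_diff[OF h' h])
    note meas = L2_space_measurable[OF h] L2_space_measurable[OF h'] L2_space_measurable[OF d]
    note [measurable] = linear_operator_measurable[OF lin meas(1)]
      linear_operator_measurable[OF lin meas(2)] linear_operator_measurable[OF lin meas(3)]
    let ?A = "{x\<in>space M. \<exists>n\<in>{N..m}. \<bar>S n h x - S N h x\<bar> > 2 * c}"
    let ?B = "{x\<in>space M. \<exists>n\<in>{N..m}. \<bar>S n h' x - S N h' x\<bar> > c}"
    let ?C = "{x\<in>space M. \<exists>n\<in>{..m}. \<bar>S n ?d x\<bar> > c / 2}"
    have lin_d: "AE x in M. \<forall>n. S n ?d x = S n h' x - S n h x"
      unfolding AE_all_countable by (intro allI linear_operator_diff lin meas)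
    have "prob ?A \<le> prob (?B \<union> ?C)"
    proof (rule finite_measure_mono_AE)
      show "AE x in M. x \<in> ?A \<longrightarrow> x \<in> ?B \<union> ?C"
        using lin_d
      proof eventually_elim
        case (elim x)
        show ?case
        proof
          assume "x \<in> ?A"
          then obtain n where n: "x \<in> space M" "N \<le> n" "n \<le> m" "\<bar>S n h x - S N h x\<bar> > 2 * c"
            by auto
          have "\<bar>S n h' x - S N h' x\<bar> > c \<or> \<bar>S n ?d x\<bar> > c / 2 \<or> \<bar>S N ?d x\<bar> > c / 2"
            using n(4) spec[OF elim, of n] spec[OF elim, of N] by linarith
          then show "x \<in> ?B \<union> ?C"
            using n(1-3) by (auto intro: order_trans)
        qed
      qed
    qed simp
    also have "\<dots> \<le> prob ?B + prob ?C"
      by (rule measure_Un_le) simp_all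
    also have "prob ?C \<le> c"
    proof -
      have "prob ?C \<le> real (card {..m}) * sqnorm M ?d / (c / 2)\<^sup>2"
        using c by (intro contraction_weak_bound con d) auto
      also have "\<dots> \<le> real (card {..m}) * \<rho> / (c / 2)\<^sup>2"
        using close by (intro divide_right_mono mult_left_mono) auto
      also have "\<dots> = c"
      proof -
        define k where "k = real m + 1"
        have "k > 0" "real (card {..m}) = k" by (simp_all add: k_def)
        then show ?thesis
          using c unfolding \<rho>_def k_def[symmetric]
          by (simp add: field_simps power2_eq_square power3_eq_cube)
      qed
      finally show ?thesis .
    qed
    finally show ?thesis using osc by linarith
  qed
  with \<rho> show ?thesis by blast
qed

text \<open>
  If the maximal inequality fails, functions with large late oscillation are dense in the unit ball
  of \<open>L\<^sup>\<infinity>\<close>. A bad function \<open>g\<close> cannot simply be added to the given \<open>g0\<close> without leaving the ball. Where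
  \<open>g\<close> and \<open>g0\<close> have the same sign, \<open>g0 - g\<close> stays in it, and elsewhere \<open>g0 + g\<close> does. The two
  functions \<open>h1\<close>, \<open>h2\<close> defined in this way satisfy \<open>h2 - h1 = g\<close>, so one of them oscillates. Small
  indices \<open>n \<le> N\<close> cannot be responsible for the large values of \<open>S n g\<close>, by
  \<open>contraction_weak_bound\<close>.
\<close>

lemma oscillation_near:
  fixes S :: "nat \<Rightarrow> ('a \<Rightarrow> real) \<Rightarrow> 'a \<Rightarrow> real"
  assumes lin: "\<And>n. linear_operator M (S n)" and con: "\<And>n. L2_contraction M (S n)"
    and \<epsilon>: "\<epsilon> > 0"
    and bad: "\<And>\<eta>. \<eta> > 0 \<Longrightarrow> \<exists>g\<in>borel_measurable M. \<exists>m. (\<forall>x. \<bar>g x\<bar> \<le> 1) \<and> sqnorm M g \<le> \<eta> \<and>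
      prob {x\<in>space M. \<exists>n\<le>m. \<bar>S n g x\<bar> > \<epsilon>} > \<epsilon>"
    and g0: "g0 \<in> borel_measurable M" "\<And>x. \<bar>g0 x\<bar> \<le> 1" and r: "r > 0"
  shows "\<exists>h\<in>borel_measurable M. \<exists>m. (\<forall>x. \<bar>h x\<bar> \<le> 1) \<and> sqnorm M (\<lambda>x. h x - g0 x) \<le> r \<and>
      prob {x\<in>space M. \<exists>n\<in>{N..m}. \<bar>S n h x - S N h x\<bar> > \<epsilon> / 4} > \<epsilon> / 4"
proof -
  define \<eta> where "\<eta> = min r (\<epsilon> ^ 3 / (8 * (real N + 1)))"
  have "\<eta> > 0" using r \<epsilon> by (simp add: \<eta>_def)
  from bad[OF this] obtain g m where g: "g \<in> borel_measurable M" "\<And>x. \<bar>g x\<bar> \<le> 1"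
    and small: "sqnorm M g \<le> \<eta>" and large: "prob {x\<in>space M. \<exists>n\<le>m. \<bar>S n g x\<bar> > \<epsilon>} > \<epsilon>"
    by blast
  define h1 where "h1 x = (if g x * g0 x \<ge> 0 then g0 x - g x else g0 x)" for x
  define h2 where "h2 x = (if g x * g0 x \<ge> 0 then g0 x else g0 x + g x)" for x
  note [measurable] = g(1) g0(1)
  have meas[measurable]: "h1 \<in> borel_measurable M" "h2 \<in> borel_measurable M"
    unfolding h1_def h2_def by measurable
  have bound: "\<bar>h1 x\<bar> \<le> 1 \<and> \<bar>h2 x\<bar> \<le> 1" for x
    using g(2)[of x] g0(2)[of x] unfolding h1_def h2_def
    by (auto simp: zero_le_mult_iff not_le mult_less_0_iff abs_le_iff)
  have gL2: "g \<in> L2_space M" by (rule bounded_in_L2_space[OF g])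
  have L2: "h1 \<in> L2_space M" "h2 \<in> L2_space M" "g0 \<in> L2_space M"
    using bound g0 by (auto intro!: bounded_in_L2_space[of _ 1])
  have close: "sqnorm M (\<lambda>x. h1 x - g0 x) \<le> r" "sqnorm M (\<lambda>x. h2 x - g0 x) \<le> r"
  proof -
    have "sqnorm M (\<lambda>x. h1 x - g0 x) \<le> sqnorm M g" "sqnorm M (\<lambda>x. h2 x - g0 x) \<le> sqnorm M g"
      using gL2 L2_space_diff[OF L2(1,3)] L2_space_diff[OF L2(2,3)]
      by (auto intro!: integral_mono simp: L2_space_def h1_def h2_def)
    then show "sqnorm M (\<lambda>x. h1 x - g0 x) \<le> r" "sqnorm M (\<lambda>x. h2 x - g0 x) \<le> r"
      using small by (auto simp: \<eta>_def)
  qed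
  have g_eq: "g = (\<lambda>x. h2 x - h1 x)"
    by (auto simp: h1_def h2_def)
  have lin_g: "AE x in M. \<forall>n. S n g x = S n h2 x - S n h1 x"
    unfolding AE_all_countable g_eq by (intro allI linear_operator_diff lin meas)
  note [measurable] = linear_operator_measurable[OF lin meas(1)]
      linear_operator_measurable[OF lin meas(2)] linear_operator_measurable[OF lin g(1)]
  let ?A = "{x\<in>space M. \<exists>n\<le>m. \<bar>S n g x\<bar> > \<epsilon>}"
  let ?B = "\<lambda>h. {x\<in>space M. \<exists>n\<in>{N..m}. \<bar>S n h x - S N h x\<bar> > \<epsilon> / 4}"
  let ?C = "{x\<in>space M. \<exists>n\<in>{..N}. \<bar>S n g x\<bar> > \<epsilon> / 2}"
  have "prob ?A \<le> prob ((?B h1 \<union> ?B h2) \<union> ?C)"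
  proof (rule finite_measure_mono_AE)
    show "AE x in M. x \<in> ?A \<longrightarrow> x \<in> (?B h1 \<union> ?B h2) \<union> ?C"
      using lin_g
    proof eventually_elim
      case (elim x)
      show ?case
      proof
        assume "x \<in> ?A"
        then obtain n where n: "x \<in> space M" "n \<le> m" "\<bar>S n g x\<bar> > \<epsilon>"
          by auto
        show "x \<in> (?B h1 \<union> ?B h2) \<union> ?C"
        proof (cases "n \<le> N")
          case True
          then have "\<exists>k\<in>{..N}. \<bar>S k g x\<bar> > \<epsilon> / 2"
            using n \<epsilon> by (intro bexI[of _ n]) auto
          then show ?thesis using n by blast
        next
          case False
          have "\<bar>S n h1 x - S N h1 x\<bar> > \<epsilon> / 4 \<or> \<bar>S n h2 x - S N h2 x\<bar> > \<epsilon> / 4 \<or> \<bar>S N g x\<bar> > \<epsilon> / 2"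
            using n(3) spec[OF elim, of n] spec[OF elim, of N] by linarith
          then show ?thesis using n False by auto
        qed
      qed
    qed
  qed simp
  also have "\<dots> \<le> prob (?B h1 \<union> ?B h2) + prob ?C"
    by (rule measure_Un_le) simp_all
  also have "prob (?B h1 \<union> ?B h2) \<le> prob (?B h1) + prob (?B h2)"
    by (rule measure_Un_le) simp_all
  also have "prob ?C \<le> \<epsilon> / 2"
  proof -
    have "prob ?C \<le> real (card {..N}) * sqnorm M g / (\<epsilon> / 2)\<^sup>2"
      using \<epsilon> by (intro contraction_weak_bound con gL2) auto
    also have "\<dots> \<le> real (card {..N}) * (\<epsilon> ^ 3 / (8 * (real N + 1))) / (\<epsilon> / 2)\<^sup>2"
      using small by (intro divide_right_mono mult_left_mono) (auto simp: \<eta>_def)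
    also have "\<dots> = \<epsilon> / 2"
    proof -
      define k where "k = real N + 1"
      have "k > 0" "real (card {..N}) = k" by (simp_all add: k_def)
      then show ?thesis
        using \<epsilon> unfolding k_def[symmetric]
        by (simp add: field_simps power2_eq_square power3_eq_cube)
    qed
    finally show ?thesis .
  qed
  finally have "prob (?B h1) > \<epsilon> / 4 \<or> prob (?B h2) > \<epsilon> / 4"
    using large by linarith
  then show ?thesis using meas bound close by blast
qed

text \<open>
  Completeness of the unit ball of \<open>L\<^sup>\<infinity>\<close> in the \<open>L\<^sup>2\<close> metric, for rapidly converging sequences: the
  increments are summable in \<open>L\<^sup>1\<close>, hence summable at almost every point.
\<close>

lemma AE_convergent_of_summable_sqnorm:
  fixes h :: "nat \<Rightarrow> 'a \<Rightarrow> real"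
  assumes h: "\<And>N. h N \<in> borel_measurable M" "\<And>N x. \<bar>h N x\<bar> \<le> 1"
    and small: "\<And>N. sqnorm M (\<lambda>x. h (Suc N) x - h N x) \<le> (1/4) ^ N"
  shows "AE x in M. convergent (\<lambda>N. h N x)"
proof -
  note [measurable] = h(1)
  let ?d = "\<lambda>N x. h (Suc N) x - h N x"
  have L1: "(\<integral>\<^sup>+x. ennreal \<bar>?d N x\<bar> \<partial>M) \<le> ennreal ((1/2) ^ N)" for N
  proof -
    have d: "?d N \<in> L2_space M"
      using h by (intro L2_space_diff bounded_in_L2_space[of _ 1]) auto
    have amgm: "\<bar>?d N x\<bar> \<le> (1/2) * (1/2) ^ N + (1/2) * 2 ^ N * (?d N x)\<^sup>2" for x
    proof -
      define p :: real where "p = 2 ^ N"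
      have p: "p > 0" "(1/2) ^ N = 1 / p" by (simp_all add: p_def power_one_over)
      have "0 \<le> (1 - p * \<bar>?d N x\<bar>)\<^sup>2" by simp
      then have "2 * (p * \<bar>?d N x\<bar>) \<le> 1 + p * (p * (?d N x)\<^sup>2)"
        by (simp add: power2_eq_square algebra_simps)
      then have "p * \<bar>?d N x\<bar> \<le> p * ((1/2) * (1/p) + (1/2) * p * (?d N x)\<^sup>2)"
        using p(1) by (simp add: algebra_simps)
      then show ?thesis using p by (simp add: p_def)
    qed
    have "\<bar>?d N x\<bar> \<le> 2" for x
      using h(2)[of N x] h(2)[of "Suc N" x] by linarith
    then have int: "integrable M (\<lambda>x. \<bar>?d N x\<bar>)"
      by (intro integrable_const_bound[of _ 2]) auto
    have "(\<integral>x. \<bar>?d N x\<bar> \<partial>M) \<le> (\<integral>x. (1/2) * (1/2) ^ N + (1/2) * 2 ^ N * (?d N x)\<^sup>2 \<partial>M)"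
      using int L2_space_integrable[OF d] amgm by (intro integral_mono) auto
    also have "\<dots> = (1/2) * (1/2) ^ N + (1/2) * 2 ^ N * sqnorm M (?d N)"
      using L2_space_integrable[OF d] by (simp add: prob_space)
    also have "\<dots> \<le> (1/2) * (1/2) ^ N + (1/2) * 2 ^ N * (1/4) ^ N"
      using small by (intro add_mono mult_left_mono) auto
    also have "\<dots> = (1/2) ^ N"
      by (simp add: power_mult_distrib[symmetric] mult.assoc)
    finally show ?thesis
      using int by (simp add: nn_integral_eq_integral ennreal_leI)
  qed
  have "(\<integral>\<^sup>+x. (\<Sum>N. ennreal \<bar>?d N x\<bar>) \<partial>M) = (\<Sum>N. \<integral>\<^sup>+x. ennreal \<bar>?d N x\<bar> \<partial>M)"
    by (rule nn_integral_suminf) simp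
  also have "\<dots> \<le> (\<Sum>N. ennreal ((1/2) ^ N))"
    using L1 by (intro suminf_le) auto
  also have "\<dots> = ennreal 2"
    using geometric_sums[of "1/2 :: real"] by (intro suminf_ennreal_eq) simp_all
  also have "\<dots> < \<infinity>" by simp
  finally have "AE x in M. (\<Sum>N. ennreal \<bar>?d N x\<bar>) \<noteq> \<infinity>"
    by (intro nn_integral_PInf_AE) auto
  then show ?thesis
  proof eventually_elim
    case (elim x)
    then have "summable (\<lambda>N. \<bar>?d N x\<bar>)"
      by (intro summable_suminf_not_top) auto
    then have "summable (\<lambda>N. ?d N x)"
      by (rule summable_rabs_cancel)
    then have "convergent (\<lambda>n. \<Sum>N<n. ?d N x)"
      by (simp add: summable_iff_convergent)
    then have "convergent (\<lambda>n. h n x - h 0 x)"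
      by (simp only: sum_lessThan_telescope[of "\<lambda>n. h n x"])
    from convergent_add[OF this convergent_const[of "h 0 x"]] show ?case
      by simp
  qed
qed

text \<open>
  If it fails, nested balls around functions supplied by \<open>oscillation_near\<close>, with radii supplied by
  \<open>oscillation_stable\<close>, shrink to a single bounded function \<open>g\<close> such that \<open>S n g\<close> oscillates beyond
  every index \<open>N\<close> on a set of probability at least \<open>c\<close>. Then \<open>S n g\<close> does not converge almost surely.
\<close>

lemma maximal_function_small:
  fixes S :: "nat \<Rightarrow> ('a \<Rightarrow> real) \<Rightarrow> 'a \<Rightarrow> real"
  assumes lin: "\<And>n. linear_operator M (S n)" and con: "\<And>n. L2_contraction M (S n)"
    and conv: "\<forall>f\<in>borel_measurable M. (\<forall>x. \<bar>f x\<bar> \<le> 1) \<longrightarrow> (AE x in M. convergent (\<lambda>n. S n f x))"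
    and \<epsilon>: "\<epsilon> > 0"
  shows "\<exists>\<eta>>0. \<forall>g\<in>borel_measurable M. (\<forall>x. \<bar>g x\<bar> \<le> 1) \<longrightarrow> sqnorm M g \<le> \<eta> \<longrightarrow>
    (\<forall>m. prob {x\<in>space M. \<exists>n\<le>m. \<bar>S n g x\<bar> > \<epsilon>} \<le> \<epsilon>)"
proof (rule ccontr)
  assume "\<not> ?thesis"
  then have bad: "\<exists>g\<in>borel_measurable M. \<exists>m. (\<forall>x. \<bar>g x\<bar> \<le> 1) \<and> sqnorm M g \<le> \<eta> \<and>
      prob {x\<in>space M. \<exists>n\<le>m. \<bar>S n g x\<bar> > \<epsilon>} > \<epsilon>" if "\<eta> > 0" for \<eta>
    using that by (meson not_le)
  \<comment> \<open>The density lemma gives the threshold \<open>\<epsilon> / 4\<close>, and stability halves it.\<close>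
  define c where "c = \<epsilon> / 8"
  have c: "c > 0" using \<epsilon> by (simp add: c_def)
  let ?X = "{h \<in> borel_measurable M. \<forall>x. \<bar>h x\<bar> \<le> 1}"
  have XL2: "h \<in> L2_space M" if "h \<in> ?X" for h
    using that by (intro bounded_in_L2_space[of _ 1]) auto
  let ?O = "\<lambda>N m h. {x\<in>space M. \<exists>n\<in>{N..m}. \<bar>S n h x - S N h x\<bar> > c}"
  \<comment> \<open>Centres and squared radii of nested balls. All functions of \<open>?X\<close> in the ball of stage \<open>N + 1\<close>
    oscillate after the index \<open>N\<close>.\<close>
  let ?P = "\<lambda>N (p :: ('a \<Rightarrow> real) \<times> real). fst p \<in> ?X \<and> 0 < snd p \<and> snd p \<le> (1/4) ^ N"
  let ?Q = "\<lambda>N (p :: ('a \<Rightarrow> real) \<times> real) p'. sqnorm M (\<lambda>x. fst p' x - fst p x) \<le> snd p / 4 \<and>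
    snd p' \<le> snd p / 4 \<and>
    (\<exists>m. \<forall>h\<in>?X. sqnorm M (\<lambda>x. h x - fst p' x) \<le> snd p' \<longrightarrow> prob (?O N m h) \<ge> c)"
  have "\<exists>f. \<forall>N. ?P N (f N) \<and> ?Q N (f N) (f (Suc N))"
  proof (rule dependent_nat_choice)
    show "\<exists>p. ?P 0 p" by (rule exI[of _ "(\<lambda>_. 0, 1)"]) simp
  next
    fix p N assume p: "?P N p"
    obtain h m where h: "h \<in> ?X" "sqnorm M (\<lambda>x. h x - fst p x) \<le> snd p / 4"
      and osc: "prob {x\<in>space M. \<exists>n\<in>{N..m}. \<bar>S n h x - S N h x\<bar> > 2 * c} > 2 * c"
      using oscillation_near[OF lin con \<epsilon> bad, of "fst p" "snd p / 4" N] p by (auto simp: c_def)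
    obtain \<rho> where \<rho>: "\<rho> > 0"
      "\<forall>h'\<in>L2_space M. sqnorm M (\<lambda>x. h' x - h x) \<le> \<rho> \<longrightarrow> prob (?O N m h') \<ge> c"
      using oscillation_stable[OF lin con c XL2[OF h(1)] osc] by blast
    show "\<exists>p'. ?P (Suc N) p' \<and> ?Q N p p'"
    proof (rule exI[of _ "(h, min \<rho> (snd p / 4))"], intro conjI)
      show "\<exists>m. \<forall>h'\<in>?X. sqnorm M (\<lambda>x. h' x - fst (h, min \<rho> (snd p / 4)) x) \<le> snd (h, min \<rho> (snd p / 4)) \<longrightarrow>
          prob (?O N m h') \<ge> c"
        using \<rho>(2) XL2 by (intro exI[of _ m]) auto
    qed (use p h \<rho> in auto)
  qed
  then obtain f where f: "\<And>N. ?P N (f N)" "\<And>N. ?Q N (f N) (f (Suc N))" by blast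
  define h where "h N = fst (f N)" for N
  define r where "r N = snd (f N)" for N
  have hX: "h N \<in> ?X" and r: "0 < r N" "r N \<le> (1/4) ^ N"
    and step: "sqnorm M (\<lambda>x. h (Suc N) x - h N x) \<le> r N / 4" "r (Suc N) \<le> r N / 4"
    and osc: "\<exists>m. \<forall>h'\<in>?X. sqnorm M (\<lambda>x. h' x - h (Suc N) x) \<le> r (Suc N) \<longrightarrow> prob (?O N m h') \<ge> c" for N
    using f(1)[of N] f(2)[of N] by (simp_all add: h_def r_def)
  have meas[measurable]: "h N \<in> borel_measurable M" and hb: "\<bar>h N x\<bar> \<le> 1" for N x
    using hX by auto
  \<comment> \<open>The factors \<open>1 / 4\<close> in the radii absorb the factors \<open>2\<close> of \<open>sqnorm_triangle\<close>.\<close>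
  have nested: "sqnorm M (\<lambda>x. h j x - h k x) \<le> r k" if "k \<le> j" for j k
    using that
  proof (induction k rule: inc_induct)
    case base
    then show ?case using r(1)[of j] by simp
  next
    case (step k)
    have "sqnorm M (\<lambda>x. h j x - h k x) \<le>
        2 * sqnorm M (\<lambda>x. h j x - h (Suc k) x) + 2 * sqnorm M (\<lambda>x. h (Suc k) x - h k x)"
      by (intro sqnorm_triangle XL2 hX)
    then show ?case
      using step.IH \<open>\<And>N. sqnorm M (\<lambda>x. h (Suc N) x - h N x) \<le> r N / 4\<close>[of k]
        \<open>\<And>N. r (Suc N) \<le> r N / 4\<close>[of k] by linarith
  qed
  have "AE x in M. convergent (\<lambda>N. h N x)"
  proof (rule AE_convergent_of_summable_sqnorm[OF meas hb])
    show "sqnorm M (\<lambda>x. h (Suc N) x - h N x) \<le> (1/4) ^ N" for N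
      using step(1)[of N] r[of N] by linarith
  qed
  \<comment> \<open>The clamping keeps \<open>g\<close> bounded at the points where the limit does not exist.\<close>
  define g where "g x = max (-1) (min 1 (lim (\<lambda>N. h N x)))" for x
  have [measurable]: "g \<in> borel_measurable M" unfolding g_def by measurable
  have gX: "g \<in> ?X" by (auto simp: g_def)
  have lim: "AE x in M. (\<lambda>N. h N x) \<longlonglongrightarrow> g x"
    using \<open>AE x in M. convergent (\<lambda>N. h N x)\<close>
  proof eventually_elim
    case (elim x)
    then have L: "(\<lambda>N. h N x) \<longlonglongrightarrow> lim (\<lambda>N. h N x)" by (simp add: convergent_LIMSEQ_iff)
    have "lim (\<lambda>N. h N x) \<le> 1" "-1 \<le> lim (\<lambda>N. h N x)"
      using hb by (auto intro!: LIMSEQ_le_const2[OF L] LIMSEQ_le_const[OF L] simp: abs_le_iff minus_le_iff)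
    then show ?case using L by (simp add: g_def)
  qed
  have close: "sqnorm M (\<lambda>x. g x - h k x) \<le> r k" for k
  proof (rule LIMSEQ_le_const2)
    show "(\<lambda>j. sqnorm M (\<lambda>x. h j x - h k x)) \<longlonglongrightarrow> sqnorm M (\<lambda>x. g x - h k x)"
    proof (rule integral_dominated_convergence[where w = "\<lambda>_. 4"])
      show "AE x in M. (\<lambda>j. (h j x - h k x)\<^sup>2) \<longlonglongrightarrow> (g x - h k x)\<^sup>2"
        using lim by eventually_elim (intro tendsto_intros)
      show "AE x in M. norm ((h j x - h k x)\<^sup>2) \<le> 4" for j
      proof (rule AE_I2)
        fix x
        have "\<bar>h j x - h k x\<bar> \<le> 2" using hb[of j x] hb[of k x] by linarith
        then have "\<bar>h j x - h k x\<bar>\<^sup>2 \<le> 2\<^sup>2" by (rule power_mono) simp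
        then show "norm ((h j x - h k x)\<^sup>2) \<le> 4" by simp
      qed
    qed simp_all
    show "\<exists>N. \<forall>j\<ge>N. sqnorm M (\<lambda>x. h j x - h k x) \<le> r k"
      using nested by blast
  qed
  note [measurable] = linear_operator_measurable[OF lin \<open>g \<in> borel_measurable M\<close>]
  let ?E = "\<lambda>N. {x\<in>space M. \<exists>n\<ge>N. \<bar>S n g x - S N g x\<bar> > c}"
  have large: "prob (?E N) \<ge> c" for N
  proof -
    obtain m where "prob (?O N m g) \<ge> c"
      using osc[of N] gX close by blast
    also have "prob (?O N m g) \<le> prob (?E N)"
      by (rule finite_measure_mono) auto
    finally show ?thesis .
  qed
  have "(\<lambda>N. \<integral>x. indicator (?E N) x \<partial>M) \<longlonglongrightarrow> (\<integral>x. (0::real) \<partial>M)"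
  proof (rule integral_dominated_convergence[where w = "\<lambda>_. 1"])
    have "AE x in M. convergent (\<lambda>n. S n g x)"
      using gX conv by blast
    then show "AE x in M. (\<lambda>N. indicator (?E N) x :: real) \<longlonglongrightarrow> 0"
    proof eventually_elim
      case (elim x)
      then have "Cauchy (\<lambda>n. S n g x)" by (rule convergent_Cauchy)
      then obtain N0 where N0: "\<And>m n. m \<ge> N0 \<Longrightarrow> n \<ge> N0 \<Longrightarrow> dist (S m g x) (S n g x) < c"
        using c unfolding Cauchy_def by blast
      have "indicator (?E N) x = (0::real)" if "N \<ge> N0" for N
      proof -
        have "\<bar>S n g x - S N g x\<bar> < c" if "n \<ge> N" for n
          using N0[of n N] \<open>N \<ge> N0\<close> that by (simp add: dist_real_def)
        then show ?thesis by (fastforce simp: indicator_def)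
      qed
      then show ?case
        by (intro tendsto_eventually) (auto simp: eventually_sequentially)
    qed
  qed (auto simp: indicator_def)
  then have "(\<lambda>N. prob (?E N)) \<longlonglongrightarrow> 0" by simp
  from LIMSEQ_le_const[OF this, of c] large c show False by force
qed

end

section \<open>Averages of squares along a Bourgain sequence\<close>

lemma rational_minimum:
  fixes a b :: real
  assumes "\<And>c. c \<in> \<rat> \<Longrightarrow> 0 \<le> a - 2 * c * b + c\<^sup>2"
  shows "b\<^sup>2 \<le> a"
proof (rule ccontr)
  assume "\<not> b\<^sup>2 \<le> a"
  then have "0 < b\<^sup>2 - a" by simp
  then have "b < b + sqrt (b\<^sup>2 - a)" by simp
  then obtain c where c: "c \<in> \<rat>" "b < c" "c < b + sqrt (b\<^sup>2 - a)"
    using Rats_dense_in_real by blast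
  have "(c - b)\<^sup>2 < (sqrt (b\<^sup>2 - a))\<^sup>2"
    using c by (intro power_strict_mono) auto
  also have "\<dots> = b\<^sup>2 - a" using \<open>0 < b\<^sup>2 - a\<close> by simp
  finally show False using assms[OF c(1)] by (simp add: power2_eq_square algebra_simps)
qed

context prob_space
begin

lemma positive_operator_mono:
  assumes lin: "linear_operator M T" and pos: "positive_operator M T"
    and f: "f \<in> borel_measurable M" and g: "g \<in> borel_measurable M" and le: "\<And>x. f x \<le> g x"
  shows "AE x in M. T f x \<le> T g x"
proof -
  have "AE x in M. 0 \<le> T (\<lambda>y. g y - f y) x"
    using pos f g le unfolding positive_operator_def by (auto intro!: AE_I2)
  with linear_operator_diff[OF lin g f] show ?thesis
    by eventually_elim simp
qed

lemma markov_operator_const: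
  assumes lin: "linear_operator M T" and one: "AE x in M. T (\<lambda>_. 1) x = 1"
  shows "AE x in M. T (\<lambda>_. c) x = c"
proof -
  have "AE x in M. T (\<lambda>_. c * 1) x = c * T (\<lambda>_. 1) x"
    by (rule linear_operator_scale[OF lin]) simp
  with one show ?thesis by eventually_elim simp
qed

lemma markov_operator_bounded:
  assumes lin: "linear_operator M T" and pos: "positive_operator M T"
    and one: "AE x in M. T (\<lambda>_. 1) x = 1"
    and f: "f \<in> borel_measurable M" "\<And>x. \<bar>f x\<bar> \<le> B"
  shows "AE x in M. \<bar>T f x\<bar> \<le> B"
proof -
  have "AE x in M. T f x \<le> T (\<lambda>_. B) x"
    using f by (intro positive_operator_mono[OF lin pos]) (auto simp: abs_le_iff)
  moreover have "AE x in M. T (\<lambda>_. -B) x \<le> T f x"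
    using f by (intro positive_operator_mono[OF lin pos]) (auto simp: abs_le_iff minus_le_iff)
  ultimately show ?thesis
    using markov_operator_const[OF lin one, of B] markov_operator_const[OF lin one, of "-B"]
    by eventually_elim simp
qed

text \<open>
  The Cauchy-Schwarz inequality for positive operators, from \<open>0 \<le> T ((f - c)\<^sup>2)\<close>. Only countably many
  \<open>c\<close> can be treated outside one null set, and the rational ones suffice.
\<close>

lemma markov_operator_square_le:
  assumes lin: "linear_operator M T" and pos: "positive_operator M T"
    and one: "AE x in M. T (\<lambda>_. 1) x = 1" and f: "f \<in> borel_measurable M"
  shows "AE x in M. (T f x)\<^sup>2 \<le> T (\<lambda>y. (f y)\<^sup>2) x"
proof -
  note [measurable] = f
  have "AE x in M. 0 \<le> T (\<lambda>y. (f y)\<^sup>2) x - 2 * c * T f x + c\<^sup>2" for c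
  proof -
    have "AE x in M. 0 \<le> T (\<lambda>y. (f y - c)\<^sup>2) x"
      using pos f unfolding positive_operator_def by (auto intro!: AE_I2)
    moreover have "(\<lambda>y. (f y - c)\<^sup>2) = (\<lambda>y. ((f y)\<^sup>2 - (2 * c) * f y) + c\<^sup>2)"
      by (simp add: fun_eq_iff power2_eq_square algebra_simps)
    ultimately have "AE x in M. 0 \<le> T (\<lambda>y. ((f y)\<^sup>2 - (2 * c) * f y) + c\<^sup>2) x"
      by simp
    moreover have "AE x in M. T (\<lambda>y. ((f y)\<^sup>2 - (2 * c) * f y) + c\<^sup>2) x =
        T (\<lambda>y. (f y)\<^sup>2 - (2 * c) * f y) x + T (\<lambda>_. c\<^sup>2) x"
      by (rule linear_operator_add[OF lin]) simp_all
    moreover have "AE x in M. T (\<lambda>y. (f y)\<^sup>2 - (2 * c) * f y) x =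
        T (\<lambda>y. (f y)\<^sup>2) x - T (\<lambda>y. (2 * c) * f y) x"
      by (rule linear_operator_diff[OF lin]) simp_all
    ultimately show ?thesis
      using linear_operator_scale[OF lin f, of "2 * c"] markov_operator_const[OF lin one, of "c\<^sup>2"]
      by eventually_elim simp
  qed
  then have "AE x in M. \<forall>c\<in>\<rat>. 0 \<le> T (\<lambda>y. (f y)\<^sup>2) x - 2 * c * T f x + c\<^sup>2"
    by (simp add: AE_ball_countable countable_rat)
  then show ?thesis
    by eventually_elim (auto intro: rational_minimum)
qed

text \<open>
  By polarisation, an isometry that fixes the constant function preserves the inner product with it.
\<close>

lemma isometry_integral_preserving:
  assumes lin: "linear_operator M T" and one: "AE x in M. T (\<lambda>_. 1) x = 1"
    and iso: "L2_isometry M T" and f: "f \<in> L2_space M"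
  shows "(\<integral>x. T f x \<partial>M) = (\<integral>x. f x \<partial>M)"
proof -
  have c: "(\<lambda>_. 1) \<in> L2_space M" by (rule bounded_in_L2_space[of _ 1]) auto
  note meas[measurable] = L2_space_measurable[OF f] L2_space_measurable[OF L2_isometry_sqnorm(1)[OF iso f]]
  have "sqnorm M (T (\<lambda>y. f y + 1)) = sqnorm M (\<lambda>x. T f x + 1)"
  proof (rule integral_cong_AE)
    show "AE x in M. (T (\<lambda>y. f y + 1) x)\<^sup>2 = (T f x + 1)\<^sup>2"
      using linear_operator_add[OF lin meas(1), of "\<lambda>_. 1"] one by auto
    show "(\<lambda>x. (T (\<lambda>y. f y + 1) x)\<^sup>2) \<in> borel_measurable M"
      by (intro borel_measurable_power linear_operator_measurable[OF lin]) simp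
  qed simp
  also have "\<dots> = sqnorm M f + 1 + 2 * (\<integral>x. T f x \<partial>M)"
    using sqnorm_add_expand[OF L2_isometry_sqnorm(1)[OF iso f] c]
    by (simp add: prob_space L2_isometry_sqnorm(2)[OF iso f])
  finally have "sqnorm M (\<lambda>y. f y + 1) = sqnorm M f + 1 + 2 * (\<integral>x. T f x \<partial>M)"
    by (simp add: L2_isometry_sqnorm(2)[OF iso L2_space_add[OF f c]])
  then show ?thesis
    using sqnorm_add_expand[OF f c] by (simp add: prob_space)
qed

text \<open>
  In \<open>(T f)\<^sup>2 \<le> T (f\<^sup>2)\<close> both sides have the integral of \<open>f\<^sup>2\<close>: the left one by the isometry property
  of \<open>T\<close>, the right one because \<open>T\<close> preserves integrals. So they agree almost everywhere.
\<close>

lemma markov_isometry_square: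
  assumes lin: "linear_operator M T" and pos: "positive_operator M T"
    and one: "AE x in M. T (\<lambda>_. 1) x = 1" and iso: "L2_isometry M T"
    and f: "f \<in> borel_measurable M" "\<And>x. \<bar>f x\<bar> \<le> B"
  shows "AE x in M. T (\<lambda>y. (f y)\<^sup>2) x = (T f x)\<^sup>2"
proof -
  note [measurable] = f(1)
  have fL: "f \<in> L2_space M" by (rule bounded_in_L2_space[OF f])
  have "\<bar>(f x)\<^sup>2\<bar> \<le> B\<^sup>2" for x
    using power_mono[OF f(2)[of x], of 2] by simp
  then have f2L: "(\<lambda>y. (f y)\<^sup>2) \<in> L2_space M"
    by (intro bounded_in_L2_space[of _ "B\<^sup>2"]) simp_all
  have int: "integrable M (T (\<lambda>y. (f y)\<^sup>2))" "integrable M (\<lambda>x. (T f x)\<^sup>2)"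
  proof -
    have "(\<lambda>_. 1) \<in> L2_space M" by (rule bounded_in_L2_space[of _ 1]) auto
    from L2_space_mult_integrable[OF L2_isometry_sqnorm(1)[OF iso f2L] this]
    show "integrable M (T (\<lambda>y. (f y)\<^sup>2))" by simp
    show "integrable M (\<lambda>x. (T f x)\<^sup>2)"
      using L2_isometry_sqnorm(1)[OF iso fL] by (rule L2_space_integrable)
  qed
  have "AE x in M. (T f x)\<^sup>2 = T (\<lambda>y. (f y)\<^sup>2) x"
  proof (rule integral_ineq_eq_0_then_AE)
    show "AE x in M. (T f x)\<^sup>2 \<le> T (\<lambda>y. (f y)\<^sup>2) x"
      by (rule markov_operator_square_le[OF lin pos one f(1)])
    show "sqnorm M (T f) = (\<integral>x. T (\<lambda>y. (f y)\<^sup>2) x \<partial>M)"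
      by (simp add: isometry_integral_preserving[OF lin one iso f2L] L2_isometry_sqnorm(2)[OF iso fL])
  qed (rule int)+
  then show ?thesis by auto
qed

text \<open>
  The mean ergodic condition for \<open>w\<^sup>2\<close>, rewritten with \<open>T j (w\<^sup>2) = (T j w)\<^sup>2\<close>. The averaged
  quantity is the variance at \<open>x\<close> of the random sum \<open>J\<^bsup>-1/2\<^esup> \<Sum> e j * T j w x\<close>.
\<close>

lemma bourgain_square_average_in_probability:
  assumes T: "bourgain_sequence M T" and w: "w \<in> borel_measurable M" "\<And>x. \<bar>w x\<bar> \<le> B"
    and \<theta>: "\<theta> > 0"
  shows "(\<lambda>J. prob {x\<in>space M. \<bar>(\<Sum>j<J. (T j w x)\<^sup>2) / real J - sqnorm M w\<bar> \<ge> \<theta>}) \<longlonglongrightarrow> 0"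
proof -
  have lin: "linear_operator M (T j)" and pos: "positive_operator M (T j)"
    and one: "AE x in M. T j (\<lambda>_. 1) x = 1" and iso: "L2_isometry M (T j)"
    and erg: "mean_ergodic M T" for j
    using T by (auto simp: bourgain_sequence_def)
  note [measurable] = w(1) linear_operator_measurable[OF lin w(1)]
  have "\<bar>(w x)\<^sup>2\<bar> \<le> B\<^sup>2" for x
    using power_mono[OF w(2)[of x], of 2] by simp
  then have w2L: "(\<lambda>y. (w y)\<^sup>2) \<in> L1_space M"
    unfolding L1_space_def by (auto intro!: integrable_const_bound[of _ "B\<^sup>2"])
  let ?D = "\<lambda>J x. (\<Sum>j<J. (T j w x)\<^sup>2) / real J - sqnorm M w"
  have eq: "AE x in M. \<forall>j. T j (\<lambda>y. (w y)\<^sup>2) x = (T j w x)\<^sup>2"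
    unfolding AE_all_countable using markov_isometry_square[OF lin pos one iso w] by blast
  have "L1_norm M (\<lambda>x. (1 / real J) * (\<Sum>j<J. T j (\<lambda>y. (w y)\<^sup>2) x) - sqnorm M w) = (\<integral>x. \<bar>?D J x\<bar> \<partial>M)" for J
    unfolding L1_norm_def
  proof (rule integral_cong_AE)
    have "T j (\<lambda>y. (w y)\<^sup>2) \<in> borel_measurable M" for j
      by (rule linear_operator_measurable[OF lin]) simp
    then show "(\<lambda>x. \<bar>(1 / real J) * (\<Sum>j<J. T j (\<lambda>y. (w y)\<^sup>2) x) - sqnorm M w\<bar>) \<in> borel_measurable M"
      by measurable
    show "AE x in M. \<bar>(1 / real J) * (\<Sum>j<J. T j (\<lambda>y. (w y)\<^sup>2) x) - sqnorm M w\<bar> = \<bar>?D J x\<bar>"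
      using eq by eventually_elim simp
  qed simp
  then have lim: "(\<lambda>J. (\<integral>x. \<bar>?D J x\<bar> \<partial>M) / \<theta>) \<longlonglongrightarrow> 0 / \<theta>"
    using erg w2L \<theta> unfolding mean_ergodic_def by (intro tendsto_divide) auto
  have bound: "prob {x\<in>space M. \<bar>?D J x\<bar> \<ge> \<theta>} \<le> (\<integral>x. \<bar>?D J x\<bar> \<partial>M) / \<theta>" for J
  proof (rule integral_Markov_inequality_measure)
    show "integrable M (\<lambda>x. \<bar>?D J x\<bar>)"
      using L2_space_integrable[OF L2_isometry_sqnorm(1)[OF iso bounded_in_L2_space[OF w]]]
      by (intro integrable_abs Bochner_Integration.integrable_diff integrable_divide
          Bochner_Integration.integrable_sum) auto
    show "space M \<in> sets M" by simp
  qed (use \<theta> in auto)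
  show ?thesis
    by (rule tendsto_sandwich[OF _ _ tendsto_const[of 0] lim[simplified]]) (use bound in auto)
qed

end

section \<open>Averages over independent random signs\<close>

text \<open>
  The expectation of \<open>\<phi> e\<close> when \<open>e 0\<close>, ..., \<open>e (J - 1)\<close> are independent random signs. The recursion on the
  number of signs makes every moment identity a one-step induction. The entries of \<open>e\<close> from \<open>J\<close> on are
  \<open>0\<close>.
\<close>

primrec sign_avg :: "nat \<Rightarrow> ((nat \<Rightarrow> real) \<Rightarrow> real) \<Rightarrow> real" where
  "sign_avg 0 \<phi> = \<phi> (\<lambda>_. 0)"
| "sign_avg (Suc J) \<phi> = (sign_avg J (\<lambda>e. \<phi> (e(J := 1))) + sign_avg J (\<lambda>e. \<phi> (e(J := -1)))) / 2"

lemma sign_avg_add: "sign_avg J (\<lambda>e. \<phi> e + \<psi> e) = sign_avg J \<phi> + sign_avg J \<psi>"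
  by (induction J arbitrary: \<phi> \<psi>) (simp_all add: field_simps)

lemma sign_avg_scale: "sign_avg J (\<lambda>e. c * \<phi> e) = c * sign_avg J \<phi>"
  by (induction J arbitrary: \<phi>) (simp_all add: field_simps)

lemma sign_avg_const: "sign_avg J (\<lambda>_. c) = c"
  by (induction J) simp_all

lemma sign_avg_sum: "finite A \<Longrightarrow> sign_avg J (\<lambda>e. \<Sum>i\<in>A. \<phi> i e) = (\<Sum>i\<in>A. sign_avg J (\<phi> i))"
  by (induction A rule: finite_induct) (simp_all add: sign_avg_const sign_avg_add)

lemma sign_avg_mono: "(\<And>e. \<phi> e \<le> \<psi> e) \<Longrightarrow> sign_avg J \<phi> \<le> sign_avg J \<psi>"
  by (induction J arbitrary: \<phi> \<psi>) (auto intro!: add_mono divide_right_mono)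

lemma sign_avg_attained:
  assumes "c \<le> sign_avg J \<phi>"
  shows "\<exists>e. c \<le> \<phi> e"
proof (rule ccontr)
  assume "\<not> ?thesis"
  then have lt: "\<And>e. \<phi> e < c" by (meson not_le)
  have "sign_avg J \<phi> < c" using lt
  proof (induction J arbitrary: \<phi>)
    case (Suc J)
    have "sign_avg J (\<lambda>e. \<phi> (e(J := 1))) < c" "sign_avg J (\<lambda>e. \<phi> (e(J := -1))) < c"
      by (intro Suc.IH Suc.prems)+
    then show ?case by simp
  qed simp
  with assms show False by simp
qed

lemma sign_avg_integral:
  assumes "\<And>e. integrable M (\<phi> e)"
  shows "integrable M (\<lambda>x. sign_avg J (\<lambda>e. \<phi> e x))"
    and "(\<integral>x. sign_avg J (\<lambda>e. \<phi> e x) \<partial>M) = sign_avg J (\<lambda>e. \<integral>x. \<phi> e x \<partial>M)"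
proof -
  have "integrable M (\<lambda>x. sign_avg J (\<lambda>e. \<phi> e x)) \<and>
    (\<integral>x. sign_avg J (\<lambda>e. \<phi> e x) \<partial>M) = sign_avg J (\<lambda>e. \<integral>x. \<phi> e x \<partial>M)"
    using assms
  proof (induction J arbitrary: \<phi>)
    case (Suc J)
    from Suc.IH[of "\<lambda>e. \<phi> (e(J := 1))"] Suc.IH[of "\<lambda>e. \<phi> (e(J := -1))"] Suc.prems
    show ?case by (simp del: fun_upd_apply)
  qed simp
  then show "integrable M (\<lambda>x. sign_avg J (\<lambda>e. \<phi> e x))"
    "(\<integral>x. sign_avg J (\<lambda>e. \<phi> e x) \<partial>M) = sign_avg J (\<lambda>e. \<integral>x. \<phi> e x \<partial>M)" by auto
qed

lemma sum_fun_upd_last: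
  fixes a :: "nat \<Rightarrow> real"
  shows "(\<Sum>j<Suc J. (e(J := s)) j * a j) = (\<Sum>j<J. e j * a j) + s * a J"
  by simp

lemma sign_avg_exp: "sign_avg J (\<lambda>e. exp (\<Sum>j<J. e j * a j)) = (\<Prod>j<J. cosh (a j))"
proof (induction J)
  case (Suc J)
  have "sign_avg (Suc J) (\<lambda>e. exp (\<Sum>j<Suc J. e j * a j)) =
    (sign_avg J (\<lambda>e. exp (a J) * exp (\<Sum>j<J. e j * a j)) +
     sign_avg J (\<lambda>e. exp (- a J) * exp (\<Sum>j<J. e j * a j))) / 2"
    by (simp only: sign_avg.simps sum_fun_upd_last exp_add) (simp add: mult.commute)
  also have "\<dots> = (\<Prod>j<J. cosh (a j)) * cosh (a J)"
    by (simp only: sign_avg_scale Suc.IH) (simp add: cosh_field_def field_simps)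
  finally show ?case by simp
qed simp

lemma sign_avg_square: "sign_avg J (\<lambda>e. (\<Sum>j<J. e j * a j)\<^sup>2) = (\<Sum>j<J. (a j)\<^sup>2)"
proof (induction J)
  case (Suc J)
  have "sign_avg (Suc J) (\<lambda>e. (\<Sum>j<Suc J. e j * a j)\<^sup>2) =
    (sign_avg J (\<lambda>e. ((\<Sum>j<J. e j * a j) + 1 * a J)\<^sup>2) + sign_avg J (\<lambda>e. ((\<Sum>j<J. e j * a j) + (-1) * a J)\<^sup>2)) / 2"
    by (simp only: sign_avg.simps sum_fun_upd_last)
  also have "\<dots> = sign_avg J (\<lambda>e. (1/2) * (((\<Sum>j<J. e j * a j) + 1 * a J)\<^sup>2 + ((\<Sum>j<J. e j * a j) + (-1) * a J)\<^sup>2))"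
    by (simp only: sign_avg_add sign_avg_scale)
  also have "\<dots> = sign_avg J (\<lambda>e. (\<Sum>j<J. e j * a j)\<^sup>2 + (a J)\<^sup>2)"
    by (simp add: power2_eq_square algebra_simps)
  finally show ?case by (simp add: sign_avg_add sign_avg_const Suc.IH)
qed simp

text \<open>
  The Paley-Zygmund inequality. The Cauchy-Schwarz step is linearised: on the event \<open>Z \<ge> m / 2\<close> use
  \<open>Z \<le> t Z\<^sup>2 / 2 + 1 / (2 t)\<close> with the optimal \<open>t\<close>.
\<close>

lemma sign_avg_paley_zygmund:
  assumes m: "sign_avg J Z > 0" and c: "c > 0"
    and second: "sign_avg J (\<lambda>e. (Z e)\<^sup>2) \<le> c * (sign_avg J Z)\<^sup>2"
  shows "1 / (4 * c) \<le> sign_avg J (\<lambda>e. of_bool (Z e \<ge> sign_avg J Z / 2))"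
proof -
  define m where "m = sign_avg J Z"
  define p where "p = sign_avg J (\<lambda>e. of_bool (Z e \<ge> m / 2))"
  \<comment> \<open>With this \<open>t\<close> the second moment takes up \<open>m / 4\<close>, so that \<open>m / 4\<close> is left for the event.\<close>
  define t where "t = 1 / (2 * c * m)"
  have pos: "m > 0" "t > 0" using m c by (auto simp: m_def t_def)
  have "Z e \<le> m / 2 + ((t / 2) * (Z e)\<^sup>2 + (1 / (2 * t)) * of_bool (Z e \<ge> m / 2))" for e
  proof (cases "Z e \<ge> m / 2")
    case True
    have "0 \<le> (t * Z e - 1)\<^sup>2 / (2 * t)" using pos by simp
    also have "\<dots> = (t / 2) * (Z e)\<^sup>2 + 1 / (2 * t) - Z e"
      using pos by (simp add: power2_eq_square field_simps)
    finally show ?thesis using True pos by simp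
  next
    case False
    have "0 \<le> (t / 2) * (Z e)\<^sup>2" using pos by simp
    then show ?thesis using False by simp
  qed
  from sign_avg_mono[where J = J and \<phi> = Z, OF this]
  have "m \<le> m / 2 + ((t / 2) * sign_avg J (\<lambda>e. (Z e)\<^sup>2) + (1 / (2 * t)) * p)"
    by (simp only: sign_avg_add sign_avg_scale sign_avg_const m_def[symmetric] p_def[symmetric])
  also have "\<dots> \<le> m / 2 + ((t / 2) * (c * m\<^sup>2) + (1 / (2 * t)) * p)"
    using second pos by (intro add_left_mono add_right_mono mult_left_mono) (auto simp: m_def)
  also have "(t / 2) * (c * m\<^sup>2) = m / 4"
    using pos c by (simp add: t_def power2_eq_square)
  also have "1 / (2 * t) = c * m"
    using pos c by (simp add: t_def)
  finally have "m * (1 / 4) \<le> m * (c * p)" by (simp add: algebra_simps)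
  then have "1 / 4 \<le> c * p" using pos(1) by (rule mult_left_le_imp_le)
  then show ?thesis using c unfolding p_def m_def by (simp add: field_simps)
qed

lemma sinh_ge_self:
  assumes "(y::real) \<ge> 0" shows "y \<le> sinh y"
proof -
  have "sinh 0 - 0 \<le> sinh y - y"
  proof (rule DERIV_nonneg_imp_nondecreasing[OF assms])
    fix x :: real
    show "\<exists>d. ((\<lambda>x. sinh x - x) has_real_derivative d) (at x) \<and> 0 \<le> d"
      by (intro exI[of _ "cosh x * 1 - 1"] conjI derivative_intros) (auto simp: cosh_real_ge_1)
  qed
  then show ?thesis by simp
qed

lemma cosh_ge_quadratic: "1 + y\<^sup>2 / 2 \<le> cosh (y::real)"
proof -
  have "cosh 0 - 0\<^sup>2 / 2 \<le> cosh \<bar>y\<bar> - \<bar>y\<bar>\<^sup>2 / 2"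
  proof (rule DERIV_nonneg_imp_nondecreasing[where f = "\<lambda>x. cosh x - x\<^sup>2 / 2"])
    fix x :: real assume "0 \<le> x"
    then show "\<exists>d. ((\<lambda>x. cosh x - x\<^sup>2 / 2) has_real_derivative d) (at x) \<and> 0 \<le> d"
      using sinh_ge_self[of x]
      by (intro exI[of _ "sinh x - x"] conjI) (auto intro!: derivative_eq_intros)
  qed simp
  then show ?thesis by simp
qed

lemma sinh_le_mult_cosh:
  assumes "(y::real) \<ge> 0" shows "sinh y \<le> y * cosh y"
proof -
  have "0 * cosh 0 - sinh 0 \<le> y * cosh y - sinh y"
  proof (rule DERIV_nonneg_imp_nondecreasing[OF assms])
    fix x :: real assume "0 \<le> x"
    then show "\<exists>d. ((\<lambda>x. x * cosh x - sinh x) has_real_derivative d) (at x) \<and> 0 \<le> d"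
      by (intro exI[of _ "x * sinh x"] conjI) (auto intro!: derivative_eq_intros)
  qed
  then show ?thesis by simp
qed

lemma cosh_le_exp_half_square: "cosh (y::real) \<le> exp (y\<^sup>2 / 2)"
proof -
  have "exp (- (\<bar>y\<bar>\<^sup>2 / 2)) * cosh \<bar>y\<bar> \<le> exp (- (0\<^sup>2 / 2)) * cosh (0::real)"
  proof (rule DERIV_nonpos_imp_nonincreasing[where f = "\<lambda>x. exp (- (x\<^sup>2 / 2)) * cosh x"])
    fix x :: real assume "0 \<le> x"
    then have "exp (- (x\<^sup>2 / 2)) * (sinh x - x * cosh x) \<le> 0"
      using sinh_le_mult_cosh[of x] by (simp add: mult_le_0_iff)
    then show "\<exists>d. ((\<lambda>x. exp (- (x\<^sup>2 / 2)) * cosh x) has_real_derivative d) (at x) \<and> d \<le> 0"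
      by (intro exI[of _ "exp (- (x\<^sup>2 / 2)) * (sinh x - x * cosh x)"] conjI)
        (auto intro!: derivative_eq_intros simp: algebra_simps)
  qed simp
  then show ?thesis by (simp add: exp_minus field_simps)
qed

text \<open>
  Together with \<open>cosh_le_exp_half_square\<close> this says that a random sum with small coefficients has
  nearly the exponential moments of a Gaussian variable.
\<close>

lemma exp_le_cosh:
  assumes "(y::real)\<^sup>2 \<le> 1" shows "exp (y\<^sup>2 / 2 - (y\<^sup>2)\<^sup>2 / 4) \<le> cosh y"
proof -
  have "y\<^sup>2 / 2 - (y\<^sup>2 / 2)\<^sup>2 \<le> ln (1 + y\<^sup>2 / 2)"
    using assms by (intro ln_one_plus_pos_lower_bound) auto
  then have "exp (y\<^sup>2 / 2 - (y\<^sup>2)\<^sup>2 / 4) \<le> exp (ln (1 + y\<^sup>2 / 2))"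
    by (simp add: power_divide)
  also have "\<dots> = 1 + y\<^sup>2 / 2" by (intro exp_ln) (auto intro: add_pos_nonneg)
  finally show ?thesis using cosh_ge_quadratic[of y] by linarith
qed

lemma sign_avg_exp_le: "sign_avg J (\<lambda>e. exp (\<Sum>j<J. e j * a j)) \<le> exp ((\<Sum>j<J. (a j)\<^sup>2) / 2)"
proof -
  have "(\<Prod>j<J. cosh (a j)) \<le> (\<Prod>j<J. exp ((a j)\<^sup>2 / 2))"
    by (intro prod_mono) (auto simp: cosh_le_exp_half_square)
  also have "\<dots> = exp ((\<Sum>j<J. (a j)\<^sup>2) / 2)" by (simp add: exp_sum sum_divide_distrib)
  finally show ?thesis by (simp only: sign_avg_exp)
qed

lemma sign_avg_exp_ge:
  assumes small: "\<And>j. j < J \<Longrightarrow> (a j)\<^sup>2 \<le> b" and b: "b \<le> 1"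
  shows "exp ((\<Sum>j<J. (a j)\<^sup>2) / 2 - b * (\<Sum>j<J. (a j)\<^sup>2) / 4) \<le> sign_avg J (\<lambda>e. exp (\<Sum>j<J. e j * a j))"
proof -
  have "exp ((\<Sum>j<J. (a j)\<^sup>2) / 2 - b * (\<Sum>j<J. (a j)\<^sup>2) / 4) = (\<Prod>j<J. exp ((a j)\<^sup>2 / 2 - b * (a j)\<^sup>2 / 4))"
    by (simp add: exp_sum[symmetric] sum_subtractf sum_divide_distrib sum_distrib_left)
  also have "\<dots> \<le> (\<Prod>j<J. cosh (a j))"
  proof (intro prod_mono conjI)
    fix j assume "j \<in> {..<J}"
    then have j: "(a j)\<^sup>2 \<le> b" using small by simp
    have "exp ((a j)\<^sup>2 / 2 - b * (a j)\<^sup>2 / 4) \<le> exp ((a j)\<^sup>2 / 2 - ((a j)\<^sup>2)\<^sup>2 / 4)"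
      using mult_right_mono[OF j, of "(a j)\<^sup>2"] by (simp add: power2_eq_square)
    also have "\<dots> \<le> cosh (a j)" using j b by (intro exp_le_cosh) simp
    finally show "exp ((a j)\<^sup>2 / 2 - b * (a j)\<^sup>2 / 4) \<le> cosh (a j)" .
  qed simp
  finally show ?thesis by (simp add: sign_avg_exp)
qed

text \<open>
  Subgaussian tails in square mean: above the level \<open>K\<close> the square is dominated by an exponential
  \<open>exp (\<mu> \<bar>t\<bar>)\<close> with \<open>\<mu> = K / 4 + 1\<close>. The summand \<open>1\<close> pays for the square; the resulting exponent
  \<open>\<mu>\<^sup>2 - (\<mu> - 1) K\<close> is a negative multiple of \<open>K\<^sup>2\<close>.
\<close>

lemma sign_avg_tail:
  assumes K: "K \<ge> 16" and a: "(\<Sum>j<J. (a j)\<^sup>2) \<le> 2"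
  shows "sign_avg J (\<lambda>e. (\<Sum>j<J. e j * a j)\<^sup>2 * of_bool (\<bar>\<Sum>j<J. e j * a j\<bar> > K)) \<le> 4 * exp (- (K\<^sup>2 / 8))"
proof -
  define \<mu> where "\<mu> = K / 4 + 1"
  let ?F = "\<lambda>e. \<Sum>j<J. e j * a j"
  have pt: "t\<^sup>2 * of_bool (\<bar>t\<bar> > K) \<le> 2 * exp (- (K\<^sup>2 / 4)) * (exp (\<mu> * t) + exp (- \<mu> * t))" for t :: real
  proof (cases "\<bar>t\<bar> > K")
    case True
    have "t\<^sup>2 \<le> 2 * exp \<bar>t\<bar>"
      using exp_lower_Taylor_quadratic[of "\<bar>t\<bar>"] by simp
    also have "exp \<bar>t\<bar> \<le> exp (\<bar>t\<bar> + (K / 4) * (\<bar>t\<bar> - K))"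
      using True K by simp
    also have "\<dots> = exp (- (K\<^sup>2 / 4)) * exp (\<mu> * \<bar>t\<bar>)"
      by (simp add: exp_add[symmetric] \<mu>_def power2_eq_square field_simps)
    also have "exp (\<mu> * \<bar>t\<bar>) \<le> exp (\<mu> * t) + exp (- \<mu> * t)"
      by (cases "t \<ge> 0") auto
    finally show ?thesis using True by simp
  qed simp
  have exps: "sign_avg J (\<lambda>e. exp (c * ?F e)) \<le> exp (\<mu>\<^sup>2)" if "c\<^sup>2 = \<mu>\<^sup>2" for c
  proof -
    have "sign_avg J (\<lambda>e. exp (c * ?F e)) = sign_avg J (\<lambda>e. exp (\<Sum>j<J. e j * (c * a j)))"
      by (simp add: sum_distrib_left mult_ac)
    also have "\<dots> \<le> exp ((\<Sum>j<J. (c * a j)\<^sup>2) / 2)" by (rule sign_avg_exp_le)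
    also have "(\<Sum>j<J. (c * a j)\<^sup>2) = \<mu>\<^sup>2 * (\<Sum>j<J. (a j)\<^sup>2)"
      by (simp add: power_mult_distrib sum_distrib_left that)
    also have "exp (\<mu>\<^sup>2 * (\<Sum>j<J. (a j)\<^sup>2) / 2) \<le> exp (\<mu>\<^sup>2)"
      using mult_left_mono[OF a, of "\<mu>\<^sup>2"] by simp
    finally show ?thesis .
  qed
  have "sign_avg J (\<lambda>e. (?F e)\<^sup>2 * of_bool (\<bar>?F e\<bar> > K)) \<le>
      sign_avg J (\<lambda>e. 2 * exp (- (K\<^sup>2 / 4)) * (exp (\<mu> * ?F e) + exp (- \<mu> * ?F e)))"
    by (rule sign_avg_mono) (rule pt)
  also have "\<dots> = 2 * exp (- (K\<^sup>2 / 4)) * (sign_avg J (\<lambda>e. exp (\<mu> * ?F e)) + sign_avg J (\<lambda>e. exp (- \<mu> * ?F e)))"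
    by (simp only: sign_avg_scale sign_avg_add)
  also have "\<dots> \<le> 2 * exp (- (K\<^sup>2 / 4)) * (exp (\<mu>\<^sup>2) + exp (\<mu>\<^sup>2))"
    by (intro mult_left_mono add_mono exps) auto
  also have "\<dots> = 4 * (exp (\<mu>\<^sup>2) * exp (- (K\<^sup>2 / 4)))" by simp
  also have "exp (\<mu>\<^sup>2) * exp (- (K\<^sup>2 / 4)) = exp (\<mu>\<^sup>2 - K\<^sup>2 / 4)"
    by (simp only: mult_exp_exp diff_conv_add_uminus)
  also have "4 * exp (\<mu>\<^sup>2 - K\<^sup>2 / 4) \<le> 4 * exp (- (K\<^sup>2 / 8))"
  proof -
    have "\<mu>\<^sup>2 \<le> (5 * K / 16)\<^sup>2" using K by (intro power_mono) (auto simp: \<mu>_def)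
    also have "\<dots> \<le> K\<^sup>2 / 8" by (simp add: power2_eq_square)
    finally show ?thesis by simp
  qed
  finally show ?thesis .
qed

text \<open>
  The lower bound \<open>1 / (4 c)\<close> of the Paley-Zygmund inequality for \<open>c = 2 exp 4\<close>.
\<close>

abbreviation max_prob :: real where
  "max_prob \<equiv> 1 / (8 * exp 4)"

text \<open>
  The maximum of \<open>k\<close> nearly normalised random sums without appreciable positive correlations is at
  least of the order \<open>L = sqrt (ln k)\<close> with probability bounded below. The second moment method is applied to \<open>Z = \<Sum> exp (L * V i)\<close>. Its mean is
  about \<open>k exp (L\<^sup>2 / 2)\<close>. In the second moment the \<open>k\<close> diagonal terms \<open>exp (2 L\<^sup>2)\<close> and the \<open>k\<^sup>2\<close>
  off-diagonal terms \<open>exp (L\<^sup>2)\<close> balance because \<open>k = exp (L\<^sup>2)\<close>, and the total is comparable to the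
  squared mean. Errors of relative size \<open>1 / L\<^sup>2\<close> in the covariances change the exponents by bounded
  amounts only. If \<open>Z\<close> is at least half its mean, some \<open>V i\<close> is at least \<open>L / 4\<close>.
\<close>

lemma sign_avg_max_large:
  fixes a :: "nat \<Rightarrow> nat \<Rightarrow> real"
  assumes k: "real k = exp (L\<^sup>2)" and L: "L \<ge> 4"
    and bound: "\<And>i j. i < k \<Longrightarrow> j < J \<Longrightarrow> \<bar>a i j\<bar> \<le> B" and J: "J > 0" "L ^ 4 * B\<^sup>2 \<le> real J"
    and diag: "\<And>i. i < k \<Longrightarrow> \<bar>(\<Sum>j<J. (a i j)\<^sup>2) / real J - 1\<bar> \<le> 1 / L\<^sup>2"
    and off: "\<And>i l. i < k \<Longrightarrow> l < k \<Longrightarrow> i \<noteq> l \<Longrightarrow> (\<Sum>j<J. (a i j + a l j)\<^sup>2) / real J \<le> 2 + 1 / L\<^sup>2"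
  shows "max_prob \<le> sign_avg J (\<lambda>e. of_bool (\<exists>i<k. L / 4 \<le> (\<Sum>j<J. e j * (a i j / sqrt (real J)))))"
proof -
  define y where "y i j = L * (a i j / sqrt (real J))" for i j
  define V where "V i e = (\<Sum>j<J. e j * (a i j / sqrt (real J)))" for i and e :: "nat \<Rightarrow> real"
  define Z where "Z e = (\<Sum>i<k. exp (L * V i e))" for e
  have L2: "L\<^sup>2 \<ge> 16" "L > 0" using power_mono[OF L, of 2] L by simp_all
  have expV: "exp (L * V i e) = exp (\<Sum>j<J. e j * y i j)" for i e
    by (simp add: V_def y_def sum_distrib_left mult_ac)
  have sumsq: "(\<Sum>j<J. (y i j)\<^sup>2) = L\<^sup>2 * ((\<Sum>j<J. (a i j)\<^sup>2) / real J)" for i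
    using J by (simp add: y_def power_mult_distrib power_divide sum_distrib_left sum_divide_distrib)
  have sumsq2: "(\<Sum>j<J. (y i j + y l j)\<^sup>2) = L\<^sup>2 * ((\<Sum>j<J. (a i j + a l j)\<^sup>2) / real J)" for i l
  proof -
    have "(y i j + y l j)\<^sup>2 = L\<^sup>2 * ((a i j + a l j)\<^sup>2 / real J)" for j
    proof -
      have "y i j + y l j = L * ((a i j + a l j) / sqrt (real J))"
        by (simp add: y_def algebra_simps add_divide_distrib)
      then show ?thesis using J by (simp add: power_mult_distrib power_divide)
    qed
    then show ?thesis by (simp add: sum_distrib_left sum_divide_distrib)
  qed
  have k0: "real k > 0" by (simp add: k)
  have low: "exp (L\<^sup>2 / 2 - 1) \<le> sign_avg J (\<lambda>e. exp (L * V i e))" if i: "i < k" for i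
  proof -
    define s where "s = (\<Sum>j<J. (y i j)\<^sup>2)"
    have "L\<^sup>2 * \<bar>(\<Sum>j<J. (a i j)\<^sup>2) / real J - 1\<bar> \<le> L\<^sup>2 * (1 / L\<^sup>2)"
      using diag[OF i] by (intro mult_left_mono) auto
    also have "L\<^sup>2 * \<bar>(\<Sum>j<J. (a i j)\<^sup>2) / real J - 1\<bar> = \<bar>s - L\<^sup>2\<bar>"
    proof -
      have "L\<^sup>2 * \<bar>(\<Sum>j<J. (a i j)\<^sup>2) / real J - 1\<bar> = \<bar>L\<^sup>2 * ((\<Sum>j<J. (a i j)\<^sup>2) / real J - 1)\<bar>"
        by (simp add: abs_mult)
      then show ?thesis by (simp only: s_def sumsq right_diff_distrib mult_1_right)
    qed
    finally have s: "\<bar>s - L\<^sup>2\<bar> \<le> 1" using L2 by (simp split: if_splits)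
    have "(y i j)\<^sup>2 \<le> 1 / L\<^sup>2" if j: "j < J" for j
    proof -
      have "(a i j)\<^sup>2 \<le> B\<^sup>2" using power_mono[OF bound[OF i j], of 2] by simp
      then have "L ^ 4 * (a i j)\<^sup>2 \<le> L ^ 4 * B\<^sup>2" by (intro mult_left_mono) auto
      also have "\<dots> \<le> real J" by (rule J)
      finally have "L\<^sup>2 * (L\<^sup>2 * (a i j)\<^sup>2) \<le> real J" by (simp add: power2_eq_square power4_eq_xxxx mult_ac)
      then have "(L\<^sup>2 * (a i j)\<^sup>2 / real J) * L\<^sup>2 \<le> 1" using J by (simp add: field_simps)
      moreover have "(y i j)\<^sup>2 = L\<^sup>2 * (a i j)\<^sup>2 / real J"
        using J by (simp add: y_def power_mult_distrib power_divide)
      ultimately have "(y i j)\<^sup>2 * L\<^sup>2 \<le> 1" by (simp only:)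
      moreover have "0 < L\<^sup>2" using L2 by linarith
      ultimately show ?thesis by (simp only: pos_le_divide_eq)
    qed
    moreover have "1 / L\<^sup>2 \<le> 1" using L2 by (subst divide_le_eq_1_pos) auto
    ultimately have "exp (s / 2 - 1 / L\<^sup>2 * s / 4) \<le> sign_avg J (\<lambda>e. exp (\<Sum>j<J. e j * y i j))"
      unfolding s_def by (rule sign_avg_exp_ge)
    moreover have "L\<^sup>2 / 2 - 1 \<le> s / 2 - 1 / L\<^sup>2 * s / 4"
    proof -
      have "1 / L\<^sup>2 * s \<le> 1 / L\<^sup>2 * (2 * L\<^sup>2)" using s L2 by (intro mult_left_mono) auto
      also have "\<dots> = 2" using L2 by simp
      finally have "1 / L\<^sup>2 * s / 4 \<le> 1 / 2" by simp
      moreover have "L\<^sup>2 / 2 - 1 / 2 \<le> s / 2" using s by linarith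
      ultimately show ?thesis by linarith
    qed
    ultimately show ?thesis by (simp add: expV order_trans[OF _ \<open>exp (s / 2 - 1 / L\<^sup>2 * s / 4) \<le> _\<close>])
  qed
  have m: "real k * exp (L\<^sup>2 / 2 - 1) \<le> sign_avg J Z"
  proof -
    have "sign_avg J Z = (\<Sum>i<k. sign_avg J (\<lambda>e. exp (L * V i e)))"
      unfolding Z_def by (rule sign_avg_sum) simp
    moreover have "(\<Sum>i<k. exp (L\<^sup>2 / 2 - 1)) \<le> \<dots>" by (intro sum_mono low) simp
    ultimately show ?thesis by simp
  qed
  \<comment> \<open>The diagonal bound \<open>exp (2 L\<^sup>2 + 2)\<close> is written as \<open>exp (L\<^sup>2 + 2) * k\<close>.\<close>
  have up: "sign_avg J (\<lambda>e. exp (L * V i e) * exp (L * V l e)) \<le>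
      exp (L\<^sup>2 + 2) + (if i = l then exp (L\<^sup>2 + 2) * real k else 0)" if il: "i < k" "l < k" for i l
  proof -
    have "sign_avg J (\<lambda>e. exp (L * V i e) * exp (L * V l e)) =
        sign_avg J (\<lambda>e. exp (\<Sum>j<J. e j * (y i j + y l j)))"
      by (simp add: expV exp_add[symmetric] sum.distrib algebra_simps)
    also have "\<dots> \<le> exp ((\<Sum>j<J. (y i j + y l j)\<^sup>2) / 2)" by (rule sign_avg_exp_le)
    also have "\<dots> \<le> (if i = l then exp (L\<^sup>2 + 2) * real k else exp (L\<^sup>2 + 2))"
    proof (cases "i = l")
      case True
      have "L\<^sup>2 * ((\<Sum>j<J. (a i j)\<^sup>2) / real J) \<le> L\<^sup>2 * (1 + 1 / L\<^sup>2)"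
        using diag[OF il(1)] by (intro mult_left_mono) auto
      also have "\<dots> = L\<^sup>2 + 1" using L2 by (simp add: distrib_left)
      finally have "(\<Sum>j<J. (y i j)\<^sup>2) \<le> L\<^sup>2 + 1" by (simp only: sumsq)
      moreover have "(\<Sum>j<J. (y i j + y l j)\<^sup>2) = 4 * (\<Sum>j<J. (y i j)\<^sup>2)"
        by (simp add: True sum_distrib_left power2_eq_square algebra_simps)
      ultimately have "(\<Sum>j<J. (y i j + y l j)\<^sup>2) / 2 \<le> (L\<^sup>2 + 2) + L\<^sup>2" by linarith
      then have "exp ((\<Sum>j<J. (y i j + y l j)\<^sup>2) / 2) \<le> exp (L\<^sup>2 + 2) * exp (L\<^sup>2)"
        unfolding exp_add[symmetric] by simp
      then show ?thesis using True by (simp add: k)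
    next
      case False
      have "L\<^sup>2 * ((\<Sum>j<J. (a i j + a l j)\<^sup>2) / real J) \<le> L\<^sup>2 * (2 + 1 / L\<^sup>2)"
        using off[OF il False] by (intro mult_left_mono) auto
      also have "\<dots> = 2 * L\<^sup>2 + 1" using L2 by (simp add: distrib_left)
      finally show ?thesis using False by (simp add: sumsq2)
    qed
    also have "\<dots> \<le> exp (L\<^sup>2 + 2) + (if i = l then exp (L\<^sup>2 + 2) * real k else 0)" by simp
    finally show ?thesis .
  qed
  have "sign_avg J (\<lambda>e. (Z e)\<^sup>2) = (\<Sum>i<k. \<Sum>l<k. sign_avg J (\<lambda>e. exp (L * V i e) * exp (L * V l e)))"
    by (simp add: Z_def power2_eq_square sum_product sign_avg_sum)
  also have "\<dots> \<le> (\<Sum>i<k. \<Sum>l<k. exp (L\<^sup>2 + 2) + (if i = l then exp (L\<^sup>2 + 2) * real k else 0))"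
    by (intro sum_mono up) auto
  also have "\<dots> = 2 * exp 4 * (real k * exp (L\<^sup>2 / 2 - 1))\<^sup>2"
  proof -
    have "exp (L\<^sup>2 + 2) = exp 4 * (exp (L\<^sup>2 / 2 - 1))\<^sup>2"
      by (simp add: power2_eq_square exp_add[symmetric])
    then show ?thesis
      by (simp add: sum.distrib power2_eq_square algebra_simps)
  qed
  also have "\<dots> \<le> 2 * exp 4 * (sign_avg J Z)\<^sup>2"
    using m by (intro mult_left_mono power_mono) auto
  finally have "1 / (4 * (2 * exp 4)) \<le> sign_avg J (\<lambda>e. of_bool (Z e \<ge> sign_avg J Z / 2))"
    using m k0 by (intro sign_avg_paley_zygmund) (auto intro: less_le_trans[OF _ m])
  also have "\<dots> \<le> sign_avg J (\<lambda>e. of_bool (\<exists>i<k. L / 4 \<le> V i e))"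
  proof (rule sign_avg_mono)
    fix e
    have "\<exists>i<k. L / 4 \<le> V i e" if Ze: "Z e \<ge> sign_avg J Z / 2"
    proof (rule ccontr)
      assume "\<not> ?thesis"
      then have "V i e < L / 4" if "i < k" for i using that by (meson not_le)
      then have "Z e < (\<Sum>i<k. exp (L * (L / 4)))"
        unfolding Z_def using L k0 by (intro sum_strict_mono) auto
      also have "\<dots> = real k * exp (L\<^sup>2 / 4)" by (simp add: power2_eq_square)
      also have "\<dots> \<le> real k * (exp (L\<^sup>2 / 2 - 1) / 2)"
      proof (rule mult_left_mono)
        have "2 * exp (L\<^sup>2 / 4) \<le> exp 1 * exp (L\<^sup>2 / 4)"
          using exp_ge_add_one_self[of 1] by (intro mult_right_mono) auto
        also have "\<dots> = exp (1 + L\<^sup>2 / 4)" by (simp add: exp_add)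
        also have "\<dots> \<le> exp (L\<^sup>2 / 2 - 1)" using L2 by simp
        finally show "exp (L\<^sup>2 / 4) \<le> exp (L\<^sup>2 / 2 - 1) / 2" by simp
      qed simp
      finally show False using Ze m by linarith
    qed
    then show "of_bool (Z e \<ge> sign_avg J Z / 2) \<le> (of_bool (\<exists>i<k. L / 4 \<le> V i e) :: real)"
      by auto
  qed
  finally show ?thesis by (simp add: V_def)
qed

section \<open>Truncation and random sums of isometries\<close>

definition clip :: "real \<Rightarrow> real \<Rightarrow> real" where
  "clip B y = max (- B) (min B y)"

lemma abs_clip_le: "0 \<le> B \<Longrightarrow> \<bar>clip B y\<bar> \<le> B"
  by (auto simp: clip_def)

lemma abs_clip_le_abs: "0 \<le> B \<Longrightarrow> \<bar>clip B y\<bar> \<le> \<bar>y\<bar>"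
  by (auto simp: clip_def)

lemma clip_zero [simp]: "0 \<le> B \<Longrightarrow> clip B 0 = 0"
  by (auto simp: clip_def)

lemma tendsto_clip: "(\<lambda>n. clip (real n) y) \<longlonglongrightarrow> y"
proof (rule tendsto_eventually)
  show "\<forall>\<^sub>F n in sequentially. clip (real n) y = y"
    using eventually_ge_at_top[of "nat \<lceil>\<bar>y\<bar>\<rceil>"]
    by eventually_elim (auto simp: clip_def nat_le_iff ceiling_le_iff abs_le_iff)
qed

lemma measurable_clip [measurable (raw)]:
  "f \<in> borel_measurable M \<Longrightarrow> (\<lambda>x. clip B (f x)) \<in> borel_measurable M"
  unfolding clip_def by (intro borel_measurable_max borel_measurable_min) simp_all

lemma sqnorm_clip_add_tendsto:
  assumes f: "f \<in> L2_space M" and g: "g \<in> L2_space M"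
  shows "(\<lambda>n. sqnorm M (\<lambda>x. clip (real n) (f x) + clip (real n) (g x))) \<longlonglongrightarrow> sqnorm M (\<lambda>x. f x + g x)"
proof -
  note [measurable] = L2_space_measurable[OF f] L2_space_measurable[OF g]
  show ?thesis
  proof (rule integral_dominated_convergence[where w = "\<lambda>x. 2 * (f x)\<^sup>2 + 2 * (g x)\<^sup>2"])
    show "integrable M (\<lambda>x. 2 * (f x)\<^sup>2 + 2 * (g x)\<^sup>2)"
      using f g by (auto simp: L2_space_def)
    show "AE x in M. (\<lambda>n. (clip (real n) (f x) + clip (real n) (g x))\<^sup>2) \<longlonglongrightarrow> (f x + g x)\<^sup>2"
      by (intro AE_I2 tendsto_intros tendsto_clip)
    show "AE x in M. norm ((clip (real n) (f x) + clip (real n) (g x))\<^sup>2) \<le> 2 * (f x)\<^sup>2 + 2 * (g x)\<^sup>2" for n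
    proof (rule AE_I2)
      fix x
      have "(clip (real n) (f x))\<^sup>2 \<le> (f x)\<^sup>2" "(clip (real n) (g x))\<^sup>2 \<le> (g x)\<^sup>2"
        by (simp_all add: abs_clip_le_abs abs_le_square_iff[symmetric])
      then show "norm ((clip (real n) (f x) + clip (real n) (g x))\<^sup>2) \<le> 2 * (f x)\<^sup>2 + 2 * (g x)\<^sup>2"
        using sum_square_le[of "clip (real n) (f x)" "clip (real n) (g x)"] by simp
    qed
  qed simp_all
qed

lemma sqnorm_clip_diff_tendsto:
  assumes f: "f \<in> L2_space M"
  shows "(\<lambda>n. sqnorm M (\<lambda>x. f x - clip (real n) (f x))) \<longlonglongrightarrow> 0"
proof -
  note [measurable] = L2_space_measurable[OF f]
  have "(\<lambda>n. sqnorm M (\<lambda>x. f x - clip (real n) (f x))) \<longlonglongrightarrow> (\<integral>x. (f x - f x)\<^sup>2 \<partial>M)"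
  proof (rule integral_dominated_convergence[where w = "\<lambda>x. (f x)\<^sup>2"])
    show "integrable M (\<lambda>x. (f x)\<^sup>2)" by (rule L2_space_integrable[OF f])
    show "AE x in M. (\<lambda>n. (f x - clip (real n) (f x))\<^sup>2) \<longlonglongrightarrow> (f x - f x)\<^sup>2"
      by (intro AE_I2 tendsto_intros tendsto_clip)
    show "AE x in M. norm ((f x - clip (real n) (f x))\<^sup>2) \<le> (f x)\<^sup>2" for n
    proof (rule AE_I2)
      fix x
      have "\<bar>f x - clip (real n) (f x)\<bar> \<le> \<bar>f x\<bar>" by (auto simp: clip_def)
      then show "norm ((f x - clip (real n) (f x))\<^sup>2) \<le> (f x)\<^sup>2"
        by (simp add: abs_le_square_iff[symmetric])
    qed
  qed simp_all
  then show ?thesis by simp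
qed

lemma sqnorm_clip_le:
  assumes f: "f \<in> L2_space M" and B: "0 \<le> B"
  shows "(\<lambda>x. clip B (f x)) \<in> L2_space M" "sqnorm M (\<lambda>x. clip B (f x)) \<le> sqnorm M f"
proof -
  note [measurable] = L2_space_measurable[OF f]
  have le: "(clip B (f x))\<^sup>2 \<le> (f x)\<^sup>2" for x
    by (simp add: abs_clip_le_abs[OF B] abs_le_square_iff[symmetric])
  have int: "integrable M (\<lambda>x. (clip B (f x))\<^sup>2)"
    using le by (intro Bochner_Integration.integrable_bound[OF L2_space_integrable[OF f]]) auto
  then show "(\<lambda>x. clip B (f x)) \<in> L2_space M" by (simp add: L2_space_def)
  show "sqnorm M (\<lambda>x. clip B (f x)) \<le> sqnorm M f"
    using le by (intro integral_mono int L2_space_integrable[OF f])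
qed

text \<open>
  One truncation level for the whole family. The lower bound on single norms and the upper bound on
  norms of sums keep the family nearly normalised and free of large positive correlations.
\<close>

lemma clip_family_approximation:
  fixes h :: "nat \<Rightarrow> 'a \<Rightarrow> real"
  assumes h: "\<And>i. i < k \<Longrightarrow> h i \<in> L2_space M" and \<rho>: "\<rho> > 0"
  shows "\<exists>n::nat. (\<forall>i<k. sqnorm M (\<lambda>x. h i x - clip (real n) (h i x)) < \<rho>) \<and>
    (\<forall>i<k. sqnorm M (h i) - \<rho> < sqnorm M (\<lambda>x. clip (real n) (h i x))) \<and>
    (\<forall>i<k. \<forall>l<k. sqnorm M (\<lambda>x. clip (real n) (h i x) + clip (real n) (h l x)) < sqnorm M (\<lambda>x. h i x + h l x) + \<rho>)"
proof -
  have "\<forall>\<^sub>F n in sequentially. sqnorm M (\<lambda>x. h i x - clip (real n) (h i x)) < \<rho>" if "i < k" for i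
    using sqnorm_clip_diff_tendsto[OF h[OF that]] \<rho> by (rule order_tendstoD)
  then have 1: "\<forall>\<^sub>F n in sequentially. \<forall>i\<in>{..<k}. sqnorm M (\<lambda>x. h i x - clip (real n) (h i x)) < \<rho>"
    by (intro eventually_ball_finite) auto
  have "\<forall>\<^sub>F n in sequentially. sqnorm M (h i) - \<rho> < sqnorm M (\<lambda>x. clip (real n) (h i x))" if "i < k" for i
  proof (rule order_tendstoD(1))
    have "(\<lambda>_. 0) \<in> L2_space M" by (simp add: L2_space_def)
    from sqnorm_clip_add_tendsto[OF h[OF that] this]
    show "(\<lambda>n. sqnorm M (\<lambda>x. clip (real n) (h i x))) \<longlonglongrightarrow> sqnorm M (h i)" by simp
  qed (use \<rho> in simp)
  then have 2: "\<forall>\<^sub>F n in sequentially. \<forall>i\<in>{..<k}. sqnorm M (h i) - \<rho> < sqnorm M (\<lambda>x. clip (real n) (h i x))"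
    by (intro eventually_ball_finite) auto
  have "\<forall>\<^sub>F n in sequentially. sqnorm M (\<lambda>x. clip (real n) (h i x) + clip (real n) (h l x)) < sqnorm M (\<lambda>x. h i x + h l x) + \<rho>"
    if "i < k" "l < k" for i l
    by (rule order_tendstoD(2)[OF sqnorm_clip_add_tendsto[OF h[OF that(1)] h[OF that(2)]]]) (use \<rho> in simp)
  then have 3: "\<forall>\<^sub>F n in sequentially. \<forall>i\<in>{..<k}. \<forall>l\<in>{..<k}.
      sqnorm M (\<lambda>x. clip (real n) (h i x) + clip (real n) (h l x)) < sqnorm M (\<lambda>x. h i x + h l x) + \<rho>"
    by (intro eventually_ball_finite ballI) auto
  from eventually_happens'[OF _ eventually_conj[OF 1 eventually_conj[OF 2 3]]]
  show ?thesis by (auto simp: Ball_def)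
qed

lemma L2_space_signed_sum:
  fixes J :: nat
  assumes "\<And>j. a j \<in> L2_space M"
  shows "(\<lambda>x. \<Sum>j<J. e j * a j x) \<in> L2_space M"
proof (induction J)
  case (Suc J)
  from L2_space_add[OF Suc L2_space_scale[OF assms]] show ?case by simp
qed (simp add: L2_space_def)

lemma sign_avg_sqnorm:
  assumes a: "\<And>j. a j \<in> L2_space M"
  shows "sign_avg J (\<lambda>e. sqnorm M (\<lambda>x. \<Sum>j<J. e j * a j x)) = (\<Sum>j<J. sqnorm M (a j))"
proof -
  have "sign_avg J (\<lambda>e. sqnorm M (\<lambda>x. \<Sum>j<J. e j * a j x)) =
      (\<integral>x. sign_avg J (\<lambda>e. (\<Sum>j<J. e j * a j x)\<^sup>2) \<partial>M)"
    by (rule sign_avg_integral(2)[symmetric]) (intro L2_space_integrable L2_space_signed_sum a)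
  also have "\<dots> = (\<integral>x. (\<Sum>j<J. (a j x)\<^sup>2) \<partial>M)"
    by (simp only: sign_avg_square)
  also have "\<dots> = (\<Sum>j<J. sqnorm M (a j))"
    by (rule Bochner_Integration.integral_sum) (rule L2_space_integrable[OF a])
  finally show ?thesis .
qed

context prob_space
begin

lemma prob_eq_integral_of_bool:
  assumes "{x\<in>space M. P x} \<in> events"
  shows "integrable M (\<lambda>x. of_bool (P x) :: real)" "prob {x\<in>space M. P x} = (\<integral>x. of_bool (P x) \<partial>M)"
proof -
  have eq: "indicat_real {x\<in>space M. P x} x = of_bool (P x)" if "x \<in> space M" for x
    using that by (auto simp: indicator_def)
  have int: "integrable M (indicat_real {x\<in>space M. P x})"
    by (rule integrable_real_indicator[OF assms]) (simp add: emeasure_eq_measure)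
  have "integrable M (indicat_real {x\<in>space M. P x}) = integrable M (\<lambda>x. of_bool (P x) :: real)"
    by (rule Bochner_Integration.integrable_cong[OF refl eq])
  with int show "integrable M (\<lambda>x. of_bool (P x) :: real)" by (rule iffD1[rotated])
  have "(\<integral>x. indicat_real {x\<in>space M. P x} x \<partial>M) = (\<integral>x. of_bool (P x) \<partial>M)"
    by (rule Bochner_Integration.integral_cong[OF refl eq])
  moreover have "(\<integral>x. indicat_real {x\<in>space M. P x} x \<partial>M) = prob {x\<in>space M. P x}"
  proof -
    have "{x\<in>space M. P x} \<inter> space M = {x\<in>space M. P x}" by auto
    then show ?thesis by simp
  qed
  ultimately show "prob {x\<in>space M. P x} = (\<integral>x. of_bool (P x) \<partial>M)" by (rule trans[OF sym, rotated])
qed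

text \<open>
  Random signs make the summands orthogonal, and each \<open>T j\<close> is an isometry.
\<close>

lemma isometric_random_sum_sqnorm:
  assumes lin: "\<And>j. linear_operator M (T j)" and iso: "\<And>j. L2_isometry M (T j)"
    and h: "h \<in> L2_space M" and u: "u \<in> L2_space M" and J: "J > 0"
  shows "sign_avg J (\<lambda>e. sqnorm M (\<lambda>x. \<Sum>j<J. e j * ((T j h x - T j u x) / sqrt (real J)))) =
    sqnorm M (\<lambda>x. h x - u x)"
proof -
  note L = L2_isometry_sqnorm(1)[OF iso h] L2_isometry_sqnorm(1)[OF iso u]
  have "(\<lambda>x. (T j h x - T j u x) / sqrt (real J)) \<in> L2_space M" for j
    using L2_space_scale[OF L2_space_diff[OF L], of "1 / sqrt (real J)"] by simp
  then have "sign_avg J (\<lambda>e. sqnorm M (\<lambda>x. \<Sum>j<J. e j * ((T j h x - T j u x) / sqrt (real J)))) =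
      (\<Sum>j<J. sqnorm M (\<lambda>x. (T j h x - T j u x) / sqrt (real J)))"
    by (rule sign_avg_sqnorm)
  also have "\<dots> = (\<Sum>j<J. sqnorm M (\<lambda>x. h x - u x) / real J)"
  proof (rule sum.cong)
    fix j
    have "sqnorm M (\<lambda>x. T j h x - T j u x) = sqnorm M (T j (\<lambda>x. h x - u x))"
    proof (rule integral_cong_AE)
      show "AE x in M. (T j h x - T j u x)\<^sup>2 = (T j (\<lambda>x. h x - u x) x)\<^sup>2"
        using linear_operator_diff[OF lin L2_space_measurable[OF h] L2_space_measurable[OF u], of j]
        by eventually_elim simp
    qed (use L2_space_measurable[OF L2_space_diff[OF L]]
        L2_space_measurable[OF L2_isometry_sqnorm(1)[OF iso L2_space_diff[OF h u]]] in auto)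
    also have "\<dots> = sqnorm M (\<lambda>x. h x - u x)"
      by (rule L2_isometry_sqnorm(2)[OF iso L2_space_diff[OF h u]])
    finally show "sqnorm M (\<lambda>x. (T j h x - T j u x) / sqrt (real J)) = sqnorm M (\<lambda>x. h x - u x) / real J"
      by (simp add: power_divide)
  qed simp
  also have "\<dots> = sqnorm M (\<lambda>x. h x - u x)" using J by simp
  finally show ?thesis .
qed

lemma bourgain_square_averages_uniform:
  assumes T: "bourgain_sequence M T" and W: "finite W"
    and w: "\<And>w. w \<in> W \<Longrightarrow> w \<in> borel_measurable M" "\<And>w. w \<in> W \<Longrightarrow> \<exists>B. \<forall>x. \<bar>w x\<bar> \<le> B"
    and \<theta>: "\<theta> > 0" and \<beta>: "\<beta> > 0"
  shows "\<forall>\<^sub>F J in sequentially.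
    prob {x\<in>space M. \<exists>w\<in>W. \<bar>(\<Sum>j<J. (T j w x)\<^sup>2) / real J - sqnorm M w\<bar> \<ge> \<theta>} < \<beta>"
proof -
  have lin: "linear_operator M (T j)" for j
    using T by (auto simp: bourgain_sequence_def)
  let ?E = "\<lambda>J w. {x\<in>space M. \<bar>(\<Sum>j<J. (T j w x)\<^sup>2) / real J - sqnorm M w\<bar> \<ge> \<theta>}"
  have "(\<lambda>J. \<Sum>w\<in>W. prob (?E J w)) \<longlonglongrightarrow> (\<Sum>w\<in>W. 0)"
  proof (rule tendsto_sum)
    fix v assume v: "v \<in> W"
    obtain B where "\<And>x. \<bar>v x\<bar> \<le> B" using w(2)[OF v] by blast
    from bourgain_square_average_in_probability[OF T w(1)[OF v] this \<theta>]
    show "(\<lambda>J. prob (?E J v)) \<longlonglongrightarrow> 0" .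
  qed
  then have "\<forall>\<^sub>F J in sequentially. (\<Sum>w\<in>W. prob (?E J w)) < \<beta>"
    using \<beta> by (intro order_tendstoD) auto
  then show ?thesis
  proof eventually_elim
    case (elim J)
    have "?E J w \<in> events" if "w \<in> W" for w
    proof -
      note [measurable] = linear_operator_measurable[OF lin w(1)[OF that]]
      show ?thesis by measurable
    qed
    then have "prob (\<Union>w\<in>W. ?E J w) \<le> (\<Sum>w\<in>W. prob (?E J w))"
      using W by (intro finite_measure_subadditive_finite) auto
    moreover have "{x\<in>space M. \<exists>w\<in>W. \<bar>(\<Sum>j<J. (T j w x)\<^sup>2) / real J - sqnorm M w\<bar> \<ge> \<theta>} = (\<Union>w\<in>W. ?E J w)"
      by auto
    ultimately show ?case using elim by simp
  qed
qed

end

section \<open>A bounded function with large images\<close>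

context prob_space
begin

lemma operator_random_sum:
  fixes J :: nat
  assumes U: "linear_operator M U" and lin: "\<And>j. linear_operator M (T j)"
    and comm: "\<And>j. commuting_operators M U (T j)" and f: "f \<in> borel_measurable M"
  shows "AE x in M. U (\<lambda>y. \<Sum>j<J. e j * (T j f y / r)) x = (\<Sum>j<J. e j * (T j (U f) x / r))"
proof -
  have "AE x in M. U (\<lambda>y. \<Sum>j<J. (e j / r) * T j f y) x = (\<Sum>j<J. (e j / r) * U (T j f) x)"
    by (rule linear_operator_sum[OF U linear_operator_measurable[OF lin f]])
  moreover have "AE x in M. \<forall>j. U (T j f) x = T j (U f) x"
    unfolding AE_all_countable using comm f by (auto simp: commuting_operators_def)
  ultimately show ?thesis by eventually_elim simp
qed

text \<open>
  The random sum \<open>F\<close> built on \<open>f\<close> is split at the height \<open>K = 4 L\<close> into \<open>K * g\<close> and \<open>G\<close>. Commutation turns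
  \<open>U i F\<close> into the random sum built on \<open>U i f\<close>, that is \<open>V i + R i\<close>, where \<open>V i\<close> is built on a bounded
  approximation \<open>u i\<close> of \<open>U i f\<close>; boundedness of \<open>u i\<close> makes the single coefficients
  \<open>T j (u i) / sqrt J\<close> small. The maximum of \<open>V i\<close> is at least \<open>L / 4\<close> with probability at
  least \<open>max_prob / 2\<close>, while \<open>U i G\<close> and \<open>R i\<close> exceed \<open>L / 16\<close> only rarely, so that \<open>U i g\<close> reaches
  \<open>L / (8 K) = 1 / 32\<close>. All estimates hold on average over the signs, and the sign pattern is chosen at the
  end.
\<close>

lemma near_orthonormal_images_large_maximum:
  fixes T U :: "nat \<Rightarrow> ('a \<Rightarrow> real) \<Rightarrow> 'a \<Rightarrow> real"
  assumes T: "bourgain_sequence M T"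
    and Ulin: "\<And>i. linear_operator M (U i)"
    and Ubd: "\<And>i g. g \<in> L2_space M \<Longrightarrow> U i g \<in> L2_space M \<and> sqnorm M (U i g) \<le> C * sqnorm M g"
    and comm: "\<And>i j. commuting_operators M (U i) (T j)"
    and f: "f \<in> borel_measurable M" "\<And>x. \<bar>f x\<bar> \<le> B" "sqnorm M f \<le> 1"
    and k: "real k = exp (L\<^sup>2)" "2560 * C \<le> max_prob * real k" and C: "C \<ge> 0" and L: "L \<ge> 4"
    and norm: "\<And>i. i < k \<Longrightarrow> sqnorm M (U i f) = 1"
    and off: "\<And>i l. i < k \<Longrightarrow> l < k \<Longrightarrow> i \<noteq> l \<Longrightarrow> (\<integral>x. U i f x * U l f x \<partial>M) \<le> 1 / (8 * L\<^sup>2)"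
  shows "\<exists>g\<in>borel_measurable M. (\<forall>x. \<bar>g x\<bar> \<le> 1) \<and> sqnorm M g \<le> 2 / (max_prob * L\<^sup>2) \<and>
    max_prob / 4 \<le> prob {x\<in>space M. \<exists>i<k. \<bar>U i g x\<bar> \<ge> 1/32}"
proof -
  define c0 where "c0 = max_prob"
  have c0: "0 < c0" by (simp add: c0_def)
  have L2: "L\<^sup>2 \<ge> 16" "L > 0" using power_mono[OF L, of 2] L by simp_all
  have k0: "real k > 0" by (simp add: k)
  have lin: "linear_operator M (T j)" and pos: "positive_operator M (T j)"
    and one: "AE x in M. T j (\<lambda>_. 1) x = 1" and iso: "L2_isometry M (T j)" for j
    using T by (auto simp: bourgain_sequence_def)
  have fL: "f \<in> L2_space M" by (rule bounded_in_L2_space[OF f(1,2)])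
  have B0: "0 \<le> B" using f(2) abs_ge_zero order_trans by blast
  define h where "h i = U i f" for i
  have h: "h i \<in> L2_space M" for i using Ubd[OF fL] by (simp add: h_def)
  \<comment> \<open>The first bound limits the change of the squared norms of the functions and of their sums, the
    second the total error of the \<open>k\<close> truncations.\<close>
  define \<rho> where "\<rho> = min (1 / (4 * L\<^sup>2)) (c0 / (512 * real k))"
  have \<rho>: "\<rho> > 0" using c0 k0 L2 by (simp add: \<rho>_def)
  obtain n :: nat where n: "\<forall>i<k. sqnorm M (\<lambda>x. h i x - clip (real n) (h i x)) < \<rho>"
      "\<forall>i<k. sqnorm M (h i) - \<rho> < sqnorm M (\<lambda>x. clip (real n) (h i x))"
      "\<forall>i<k. \<forall>l<k. sqnorm M (\<lambda>x. clip (real n) (h i x) + clip (real n) (h l x)) < sqnorm M (\<lambda>x. h i x + h l x) + \<rho>"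
    using clip_family_approximation[where h = h and k = k, OF h \<rho>] by blast
  define u where "u i x = clip (real n) (h i x)" for i x
  have u: "u i \<in> L2_space M" "sqnorm M (u i) \<le> sqnorm M (h i)" "\<bar>u i x\<bar> \<le> real n" for i x
    using sqnorm_clip_le[OF h, of "real n" i] by (simp_all add: u_def[abs_def] abs_clip_le)
  have umeas: "u i \<in> borel_measurable M" for i by (rule L2_space_measurable[OF u(1)])
  have u_close: "sqnorm M (\<lambda>x. h i x - u i x) \<le> c0 / (512 * real k)" if "i < k" for i
    using n(1) that by (force simp: u_def \<rho>_def)
  have u_diag: "\<bar>sqnorm M (u i) - 1\<bar> \<le> 1 / (4 * L\<^sup>2)" if "i < k" for i
  proof -
    have "1 - \<rho> < sqnorm M (u i)" using n(2) norm that by (auto simp: u_def[abs_def] h_def)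
    moreover have "sqnorm M (u i) \<le> 1" using u(2)[of i] norm[OF that] by (simp add: h_def)
    moreover have "\<rho> \<le> 1 / (4 * L\<^sup>2)" by (simp add: \<rho>_def)
    ultimately show ?thesis by linarith
  qed
  have u_off: "sqnorm M (\<lambda>x. u i x + u l x) \<le> 2 + 1 / (2 * L\<^sup>2)" if "i < k" "l < k" "i \<noteq> l" for i l
  proof -
    have "sqnorm M (\<lambda>x. h i x + h l x) = 2 + 2 * (\<integral>x. h i x * h l x \<partial>M)"
      using sqnorm_add_expand[OF h[of i] h[of l]] norm that by (simp add: h_def)
    moreover have "2 * (\<integral>x. h i x * h l x \<partial>M) \<le> 2 * (1 / (8 * L\<^sup>2))"
      using off[OF that] by (intro mult_left_mono) (auto simp: h_def)
    moreover have "sqnorm M (\<lambda>x. u i x + u l x) < sqnorm M (\<lambda>x. h i x + h l x) + \<rho>"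
      using n(3) that by (simp add: u_def)
    moreover have "\<rho> \<le> 1 / (4 * L\<^sup>2)" by (simp add: \<rho>_def)
    moreover have "2 * (1 / (8 * L\<^sup>2)) = 1 / (4 * L\<^sup>2)" "1 / (2 * L\<^sup>2) = 1 / (4 * L\<^sup>2) + 1 / (4 * L\<^sup>2)" by simp_all
    ultimately show ?thesis by linarith
  qed
  define pair where "pair i l x = u i x + u l x" for i l x
  \<comment> \<open>The variances of the random sums built on \<open>f\<close>, on the \<open>u i\<close> and on their pairwise sums have to be
    near their limits.\<close>
  define W where "W = insert f (u ` {..<k} \<union> (\<lambda>(i, l). pair i l) ` ({..<k} \<times> {..<k}))"
  define \<theta> where "\<theta> = 1 / (2 * L\<^sup>2)"
  \<comment> \<open>On the exceptional set the variance of \<open>F\<close> is at most \<open>B\<^sup>2\<close>, so this set contributes at most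
    \<open>1 / k\<^sup>2\<close> to the tail of \<open>F\<close>.\<close>
  define \<beta> where "\<beta> = min (1 / 2) (1 / ((real k)\<^sup>2 * (B\<^sup>2 + 1)))"
  define Bad where "Bad J = {x\<in>space M. \<exists>w\<in>W. \<bar>(\<Sum>j<J. (T j w x)\<^sup>2) / real J - sqnorm M w\<bar> \<ge> \<theta>}" for J
  have B1: "B\<^sup>2 + 1 > 0" by (intro add_nonneg_pos) auto
  have \<beta>: "\<beta> > 0" "\<beta> \<le> 1 / 2" "B\<^sup>2 * \<beta> \<le> 1 / (real k)\<^sup>2"
  proof -
    show "\<beta> > 0" using B1 k0 by (simp add: \<beta>_def)
    show "\<beta> \<le> 1 / 2" by (simp add: \<beta>_def)
    have "B\<^sup>2 * \<beta> \<le> (B\<^sup>2 + 1) * (1 / ((real k)\<^sup>2 * (B\<^sup>2 + 1)))"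
      using \<open>\<beta> > 0\<close> by (intro mult_mono) (auto simp: \<beta>_def)
    also have "\<dots> = 1 / (real k)\<^sup>2" using B1 by simp
    finally show "B\<^sup>2 * \<beta> \<le> 1 / (real k)\<^sup>2" .
  qed
  have pair_meas: "pair i l \<in> borel_measurable M" for i l
    unfolding pair_def using umeas by simp
  have W_meas: "w \<in> borel_measurable M" if "w \<in> W" for w
    using that f(1) umeas pair_meas by (auto simp: W_def)
  have pair_bd: "\<bar>pair i l x\<bar> \<le> 2 * real n" for i l x
    using u(3)[of i x] u(3)[of l x] unfolding pair_def by linarith
  have W_bd: "\<exists>D. \<forall>x. \<bar>w x\<bar> \<le> D" if "w \<in> W" for w
  proof -
    from that have "w = f \<or> (\<exists>i. w = u i) \<or> (\<exists>i l. w = pair i l)"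
      unfolding W_def by auto
    moreover have "\<bar>u i x\<bar> \<le> 2 * real n" for i x
      using u(3)[of i x] by linarith
    ultimately have "\<forall>x. \<bar>w x\<bar> \<le> max B (2 * real n)"
      using f(2) pair_bd by (elim disjE exE) (simp_all add: le_max_iff_disj)
    then show ?thesis by blast
  qed
  have "\<forall>\<^sub>F J in sequentially. prob (Bad J) < \<beta>"
    unfolding Bad_def
    by (rule bourgain_square_averages_uniform[OF T]) (use W_meas W_bd \<beta> L2 in \<open>auto simp: W_def \<theta>_def\<close>)
  moreover have "\<forall>\<^sub>F J in sequentially. real J \<ge> L ^ 4 * (real n)\<^sup>2 + 1"
    using eventually_ge_at_top[of "nat \<lceil>L ^ 4 * (real n)\<^sup>2 + 1\<rceil>"]
    by eventually_elim (meson of_nat_le_iff order_trans real_nat_ceiling_ge)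
  ultimately have "\<forall>\<^sub>F J in sequentially. prob (Bad J) < \<beta> \<and> real J \<ge> L ^ 4 * (real n)\<^sup>2 + 1"
    by (rule eventually_conj)
  then obtain J where J: "prob (Bad J) < \<beta>" "real J \<ge> L ^ 4 * (real n)\<^sup>2 + 1"
    using eventually_happens'[OF sequentially_bot] by blast
  have J0: "J > 0" "L ^ 4 * (real n)\<^sup>2 \<le> real J"
  proof -
    have "0 \<le> L ^ 4 * (real n)\<^sup>2" by simp
    then have "real J > 0" using J(2) by linarith
    then show "J > 0" by simp
    show "L ^ 4 * (real n)\<^sup>2 \<le> real J" using J(2) by linarith
  qed
  define r where "r = sqrt (real J)"
  have r: "r > 0" "r\<^sup>2 = real J" using J0 by (simp_all add: r_def)
  have Tmeas: "T j w \<in> borel_measurable M" if "w \<in> borel_measurable M" for j w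
    by (rule linear_operator_measurable[OF lin that])
  note [measurable] = f(1) umeas Tmeas[OF f(1)] Tmeas[OF umeas] L2_space_measurable[OF h]
    Tmeas[OF L2_space_measurable[OF h]] W_meas
  have W_fin: "finite W" by (simp add: W_def)
  have Bad_meas[measurable]: "Bad J \<in> events"
  proof -
    have "{x\<in>space M. \<bar>(\<Sum>j<J. (T j w x)\<^sup>2) / real J - sqnorm M w\<bar> \<ge> \<theta>} \<in> events" if "w \<in> W" for w
    proof -
      note [measurable] = Tmeas[OF W_meas[OF that]]
      show ?thesis by measurable
    qed
    then have "(\<Union>w\<in>W. {x\<in>space M. \<bar>(\<Sum>j<J. (T j w x)\<^sup>2) / real J - sqnorm M w\<bar> \<ge> \<theta>}) \<in> events"
      using W_fin by (intro sets.finite_UN) auto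
    also have "(\<Union>w\<in>W. {x\<in>space M. \<bar>(\<Sum>j<J. (T j w x)\<^sup>2) / real J - sqnorm M w\<bar> \<ge> \<theta>}) = Bad J"
      by (auto simp: Bad_def)
    finally show ?thesis .
  qed
  define F where "F e x = (\<Sum>j<J. e j * (T j f x / r))" for e x
  define V where "V i e x = (\<Sum>j<J. e j * (T j (u i) x / r))" for i e x
  define R where "R i e x = (\<Sum>j<J. e j * ((T j (h i) x - T j (u i) x) / r))" for i e x
  define K where "K = 4 * L"
  have K: "K \<ge> 16" using L by (simp add: K_def)
  define G where "G e x = F e x * of_bool (\<bar>F e x\<bar> > K)" for e x
  define g where "g e x = F e x * of_bool (\<bar>F e x\<bar> \<le> K) / K" for e x
  have [measurable]: "F e \<in> borel_measurable M" "V i e \<in> borel_measurable M" "R i e \<in> borel_measurable M" for e i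
    unfolding F_def V_def R_def by measurable
  have gmeas[measurable]: "g e \<in> borel_measurable M" for e
    unfolding g_def by measurable
  have FL: "F e \<in> L2_space M" for e
    unfolding F_def
  proof (rule L2_space_signed_sum)
    show "(\<lambda>x. T j f x / r) \<in> L2_space M" for j
      using L2_space_scale[OF L2_isometry_sqnorm(1)[OF iso fL], of "1 / r"] by simp
  qed
  have RL: "R i e \<in> L2_space M" for i e
    unfolding R_def
  proof (rule L2_space_signed_sum)
    show "(\<lambda>x. (T j (h i) x - T j (u i) x) / r) \<in> L2_space M" for j
      using L2_space_scale[OF L2_space_diff[OF L2_isometry_sqnorm(1)[OF iso h] L2_isometry_sqnorm(1)[OF iso u(1)]], of "1 / r"]
      by simp
  qed
  have GL: "G e \<in> L2_space M" for e
  proof -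
    have "integrable M (\<lambda>x. (G e x)\<^sup>2)"
      by (rule Bochner_Integration.integrable_bound[OF L2_space_integrable[OF FL[of e]]])
        (auto simp: G_def)
    moreover have "G e \<in> borel_measurable M" unfolding G_def by measurable
    ultimately show ?thesis by (simp add: L2_space_def)
  qed
  have g1: "\<bar>g e x\<bar> \<le> 1" for e x using K by (auto simp: g_def)
  have g2: "sqnorm M (g e) \<le> sqnorm M (F e) / K\<^sup>2" for e
  proof -
    have "sqnorm M (g e) \<le> (\<integral>x. (F e x)\<^sup>2 / K\<^sup>2 \<partial>M)"
      using L2_space_integrable[OF FL[of e]] L2_space_integrable[OF bounded_in_L2_space[OF gmeas g1]] K
      by (intro integral_mono) (auto simp: g_def power_divide)
    then show ?thesis by simp
  qed
  let ?A = "\<lambda>e. {x\<in>space M. \<exists>i<k. L / 4 \<le> V i e x}"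
  let ?P = "\<lambda>e. {x\<in>space M. \<exists>i<k. \<bar>U i (g e) x\<bar> \<ge> 1/32}"
  have split: "prob (?A e) \<le> prob (?P e) + 16 * (real k * (C * sqnorm M (G e))) + 16 * (\<Sum>i<k. sqnorm M (R i e))" for e
  proof -
    let ?Q = "{x\<in>space M. \<exists>i\<in>{..<k}. \<bar>U i (G e) x\<bar> > L / 16}"
    let ?S = "{x\<in>space M. \<exists>i\<in>{..<k}. \<bar>R i e x\<bar> > L / 16}"
    note [measurable] = linear_operator_measurable[OF Ulin L2_space_measurable[OF GL]]
      linear_operator_measurable[OF Ulin gmeas]
    have dec: "AE x in M. \<forall>i. V i e x = K * U i (g e) x + U i (G e) x - R i e x"
      unfolding AE_all_countable
    proof
      fix i
      have eqF: "F e = (\<lambda>x. K * g e x + G e x)"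
        using K by (auto simp: fun_eq_iff g_def G_def)
      have "AE x in M. U i (F e) x = U i (\<lambda>x. K * g e x) x + U i (G e) x"
        by (subst eqF, rule linear_operator_add[OF Ulin])
          (use L2_space_measurable[OF GL[of e]] in auto)
      moreover have "AE x in M. U i (\<lambda>x. K * g e x) x = K * U i (g e) x"
        by (rule linear_operator_scale[OF Ulin gmeas])
      moreover have "AE x in M. U i (F e) x = (\<Sum>j<J. e j * (T j (h i) x / r))"
        unfolding F_def[abs_def] h_def by (rule operator_random_sum[OF Ulin lin comm f(1)])
      ultimately show "AE x in M. V i e x = K * U i (g e) x + U i (G e) x - R i e x"
        by eventually_elim (simp add: V_def R_def diff_divide_distrib right_diff_distrib sum_subtractf)
    qed
    have "prob (?A e) \<le> prob ((?P e \<union> ?Q) \<union> ?S)"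
    proof (rule finite_measure_mono_AE)
      show "AE x in M. x \<in> ?A e \<longrightarrow> x \<in> (?P e \<union> ?Q) \<union> ?S"
        using dec
      proof eventually_elim
        case (elim x)
        show ?case
        proof
          assume "x \<in> ?A e"
          then obtain i where i: "x \<in> space M" "i < k" "L / 4 \<le> V i e x" by auto
          have "L / 8 \<le> K * U i (g e) x \<or> \<bar>U i (G e) x\<bar> > L / 16 \<or> \<bar>R i e x\<bar> > L / 16"
            using spec[OF elim, of i] i(3) by linarith
          moreover have "1 / 32 \<le> \<bar>U i (g e) x\<bar>" if "L / 8 \<le> K * U i (g e) x"
          proof -
            have "L * (1 / 32) \<le> L * U i (g e) x" using that by (simp add: K_def)
            then have "1 / 32 \<le> U i (g e) x" by (rule mult_left_le_imp_le) (use L in simp)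
            then show ?thesis by simp
          qed
          ultimately show "x \<in> (?P e \<union> ?Q) \<union> ?S" using i(1,2) by blast
        qed
      qed
    qed simp
    also have "\<dots> \<le> prob (?P e \<union> ?Q) + prob ?S" by (rule measure_Un_le) simp_all
    also have "prob (?P e \<union> ?Q) \<le> prob (?P e) + prob ?Q" by (rule measure_Un_le) simp_all
    also have "prob ?Q \<le> 16 * (real k * (C * sqnorm M (G e)))"
    proof -
      have "prob ?Q \<le> (\<Sum>i<k. sqnorm M (U i (G e))) / (L / 16)\<^sup>2"
        using Ubd[OF GL] L by (intro chebyshev_sqnorm_finite_family) auto
      also have "\<dots> \<le> (\<Sum>i<k. sqnorm M (U i (G e))) / (1 / 16)"
        using L2 by (intro divide_left_mono sum_nonneg) (auto simp: power_divide)
      also have "\<dots> \<le> (\<Sum>i<k. C * sqnorm M (G e)) / (1 / 16)"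
        using Ubd[OF GL] by (intro divide_right_mono sum_mono) auto
      finally show ?thesis by simp
    qed
    also have "prob ?S \<le> 16 * (\<Sum>i<k. sqnorm M (R i e))"
    proof -
      have "prob ?S \<le> (\<Sum>i<k. sqnorm M (R i e)) / (L / 16)\<^sup>2"
        using RL L by (intro chebyshev_sqnorm_finite_family) auto
      also have "\<dots> \<le> (\<Sum>i<k. sqnorm M (R i e)) / (1 / 16)"
        using L2 by (intro divide_left_mono sum_nonneg) (auto simp: power_divide)
      finally show ?thesis by simp
    qed
    finally show ?thesis by linarith
  qed
  have avgF: "sign_avg J (\<lambda>e. sqnorm M (F e)) \<le> 1"
  proof -
    \<comment> \<open>\<open>F\<close> is the random sum of \<open>isometric_random_sum_sqnorm\<close> for the pair \<open>f\<close> and \<open>0\<close>.\<close>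
    have z: "(\<lambda>_. 0) \<in> L2_space M" by (simp add: L2_space_def)
    have T0: "AE x in M. \<forall>j. T j (\<lambda>_. 0) x = 0"
      unfolding AE_all_countable by (intro allI markov_operator_const[OF lin one])
    have "sqnorm M (F e) = sqnorm M (\<lambda>x. \<Sum>j<J. e j * ((T j f x - T j (\<lambda>_. 0) x) / sqrt (real J)))" for e
    proof (rule integral_cong_AE)
      note [measurable] = Tmeas[OF L2_space_measurable[OF z]]
      show "(\<lambda>x. (\<Sum>j<J. e j * ((T j f x - T j (\<lambda>_. 0) x) / sqrt (real J)))\<^sup>2) \<in> borel_measurable M"
        by measurable
      show "AE x in M. (F e x)\<^sup>2 = (\<Sum>j<J. e j * ((T j f x - T j (\<lambda>_. 0) x) / sqrt (real J)))\<^sup>2"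
        using T0 by eventually_elim (simp add: F_def r_def)
    qed simp
    then show ?thesis
      using isometric_random_sum_sqnorm[OF lin iso fL z J0(1)] f(3) by simp
  qed
  have avgR: "sign_avg J (\<lambda>e. 16 * (\<Sum>i<k. sqnorm M (R i e))) \<le> c0 / 32"
  proof -
    have "sign_avg J (\<lambda>e. 16 * (\<Sum>i<k. sqnorm M (R i e))) = 16 * (\<Sum>i<k. sqnorm M (\<lambda>x. h i x - u i x))"
      unfolding R_def r_def
      by (simp only: sign_avg_scale sign_avg_sum[OF finite_lessThan]
          isometric_random_sum_sqnorm[OF lin iso h u(1) J0(1)])
    also have "\<dots> \<le> 16 * (\<Sum>i<k. c0 / (512 * real k))"
      using u_close by (intro mult_left_mono sum_mono) auto
    also have "\<dots> = c0 / 32" using k0 by simp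
    finally show ?thesis .
  qed
  have bdT: "AE x in M. \<forall>i j. \<bar>T j (u i) x\<bar> \<le> real n"
    unfolding AE_all_countable by (intro allI markov_operator_bounded[OF lin pos one umeas u(3)])
  have bdTf: "AE x in M. \<forall>j. \<bar>T j f x\<bar> \<le> B"
    unfolding AE_all_countable by (intro allI markov_operator_bounded[OF lin pos one f(1,2)])
  have addT: "AE x in M. \<forall>i l j. T j (pair i l) x = T j (u i) x + T j (u l) x"
    unfolding AE_all_countable pair_def by (intro allI linear_operator_add[OF lin umeas umeas])
  have good: "\<bar>(\<Sum>j<J. (T j w x)\<^sup>2) / real J - sqnorm M w\<bar> < \<theta>" if "x \<in> space M" "x \<notin> Bad J" "w \<in> W" for x w
    using that by (force simp: Bad_def)
  have avgG: "sign_avg J (\<lambda>e. sqnorm M (G e)) \<le> 5 / (real k)\<^sup>2"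
  proof -
    have "sign_avg J (\<lambda>e. sqnorm M (G e)) = (\<integral>x. sign_avg J (\<lambda>e. (G e x)\<^sup>2) \<partial>M)"
      by (rule sign_avg_integral(2)[symmetric]) (rule L2_space_integrable[OF GL])
    also have "\<dots> \<le> (\<integral>x. 4 / (real k)\<^sup>2 + B\<^sup>2 * indicator (Bad J) x \<partial>M)"
    proof (rule integral_mono_AE)
      show "integrable M (\<lambda>x. sign_avg J (\<lambda>e. (G e x)\<^sup>2))"
        by (rule sign_avg_integral(1)) (rule L2_space_integrable[OF GL])
      show "integrable M (\<lambda>x. 4 / (real k)\<^sup>2 + B\<^sup>2 * indicator (Bad J) x)"
        by (auto simp: emeasure_eq_measure)
      show "AE x in M. sign_avg J (\<lambda>e. (G e x)\<^sup>2) \<le> 4 / (real k)\<^sup>2 + B\<^sup>2 * indicator (Bad J) x"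
        using bdTf AE_space
      proof eventually_elim
        case (elim x)
        have sum_eq: "(\<Sum>j<J. (T j f x / r)\<^sup>2) = (\<Sum>j<J. (T j f x)\<^sup>2) / real J"
          by (simp add: power_divide r sum_divide_distrib)
        have Gsq: "(G e x)\<^sup>2 = (F e x)\<^sup>2 * of_bool (\<bar>F e x\<bar> > K)" for e
          by (simp add: G_def)
        show ?case
        proof (cases "x \<in> Bad J")
          case True
          have "sign_avg J (\<lambda>e. (G e x)\<^sup>2) \<le> sign_avg J (\<lambda>e. (F e x)\<^sup>2)"
            by (rule sign_avg_mono) (simp add: Gsq)
          also have "\<dots> = (\<Sum>j<J. (T j f x)\<^sup>2) / real J"
            by (simp only: F_def sign_avg_square sum_eq)
          also have "\<dots> \<le> (\<Sum>j<J. B\<^sup>2) / real J"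
            using elim(1) B0 by (intro divide_right_mono sum_mono) (auto simp: abs_le_square_iff[symmetric])
          also have "\<dots> = B\<^sup>2" using J0 by simp
          finally show ?thesis using True by (simp add: add_increasing)
        next
          case False
          have "\<bar>(\<Sum>j<J. (T j f x)\<^sup>2) / real J - sqnorm M f\<bar> < \<theta>"
            by (rule good[OF elim(2) False]) (simp add: W_def)
          moreover have "\<theta> \<le> 1" using L2 by (simp add: \<theta>_def divide_le_eq)
          ultimately have "(\<Sum>j<J. (T j f x / r)\<^sup>2) \<le> 2"
            unfolding sum_eq using f(3) by linarith
          from sign_avg_tail[OF K this]
          have "sign_avg J (\<lambda>e. (G e x)\<^sup>2) \<le> 4 * exp (- (K\<^sup>2 / 8))"
            by (simp add: Gsq F_def)
          also have "exp (- (K\<^sup>2 / 8)) = exp (- (L\<^sup>2)) * exp (- (L\<^sup>2))"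
            by (simp add: mult_exp_exp K_def power_mult_distrib)
          also have "\<dots> = 1 / (real k)\<^sup>2"
            by (simp add: k(1) exp_minus power2_eq_square divide_inverse)
          finally show ?thesis using False by simp
        qed
      qed
    qed
    also have "\<dots> = 4 / (real k)\<^sup>2 + B\<^sup>2 * prob (Bad J)"
      by (simp add: emeasure_eq_measure prob_space)
    also have "\<dots> \<le> 4 / (real k)\<^sup>2 + B\<^sup>2 * \<beta>"
      using J(1) by (intro add_left_mono mult_left_mono) auto
    also have "\<dots> \<le> 5 / (real k)\<^sup>2"
      using \<beta>(3) by (simp add: field_simps)
    finally show ?thesis .
  qed
  have avgG': "sign_avg J (\<lambda>e. 16 * (real k * (C * sqnorm M (G e)))) \<le> c0 / 32"
  proof -
    have "sign_avg J (\<lambda>e. 16 * (real k * (C * sqnorm M (G e)))) = 16 * (real k * (C * sign_avg J (\<lambda>e. sqnorm M (G e))))"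
      by (simp only: sign_avg_scale)
    also have "\<dots> \<le> 16 * (real k * (C * (5 / (real k)\<^sup>2)))"
      using avgG C by (intro mult_left_mono) auto
    also have "\<dots> = 80 * C / real k" using k0 by (simp add: power2_eq_square)
    also have "\<dots> \<le> c0 / 32"
      using k(2) k0 unfolding c0_def[symmetric] by (simp add: field_simps)
    finally show ?thesis .
  qed
  have avgA: "c0 / 2 \<le> sign_avg J (\<lambda>e. prob (?A e))"
  proof -
    have A_meas: "?A e \<in> events" for e by measurable
    have "c0 / 2 \<le> c0 * (1 - prob (Bad J))"
      using J(1) \<beta>(2) c0 by (simp add: field_simps)
    also have "1 - prob (Bad J) = prob (space M - Bad J)" by (simp add: prob_compl)
    also have "c0 * prob (space M - Bad J) = (\<integral>x. c0 * indicator (space M - Bad J) x \<partial>M)"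
      by (simp add: Int_absorb2)
    also have "\<dots> \<le> (\<integral>x. sign_avg J (\<lambda>e. of_bool (\<exists>i<k. L / 4 \<le> V i e x)) \<partial>M)"
    proof (rule integral_mono_AE)
      show "integrable M (\<lambda>x. c0 * indicator (space M - Bad J) x)"
        by (auto simp: emeasure_eq_measure)
      show "integrable M (\<lambda>x. sign_avg J (\<lambda>e. of_bool (\<exists>i<k. L / 4 \<le> V i e x)))"
        by (intro sign_avg_integral(1) prob_eq_integral_of_bool(1) A_meas)
      show "AE x in M. c0 * indicator (space M - Bad J) x \<le> sign_avg J (\<lambda>e. of_bool (\<exists>i<k. L / 4 \<le> V i e x))"
        using bdT addT AE_space
      proof eventually_elim
        case (elim x)
        show ?case
        proof (cases "x \<in> Bad J")
          case True
          have "sign_avg J (\<lambda>_. 0) \<le> sign_avg J (\<lambda>e. of_bool (\<exists>i<k. L / 4 \<le> V i e x))"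
            by (rule sign_avg_mono) simp
          then show ?thesis using True by (simp add: sign_avg_const)
        next
          case False
          have half: "\<theta> + 1 / (4 * L\<^sup>2) \<le> 1 / L\<^sup>2" "1 / (2 * L\<^sup>2) + \<theta> = 1 / L\<^sup>2"
            using L2 by (auto simp: \<theta>_def field_simps)
          have "max_prob \<le> sign_avg J (\<lambda>e. of_bool (\<exists>i<k. L / 4 \<le> (\<Sum>j<J. e j * (T j (u i) x / sqrt (real J)))))"
          proof (rule sign_avg_max_large[OF k(1) L _ J0])
            fix i j assume "i < k" "j < J"
            then show "\<bar>T j (u i) x\<bar> \<le> real n" using elim(1) by simp
          next
            fix i assume i: "i < k"
            have "\<bar>(\<Sum>j<J. (T j (u i) x)\<^sup>2) / real J - sqnorm M (u i)\<bar> < \<theta>"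
              by (rule good[OF elim(3) False]) (use i in \<open>simp add: W_def\<close>)
            then show "\<bar>(\<Sum>j<J. (T j (u i) x)\<^sup>2) / real J - 1\<bar> \<le> 1 / L\<^sup>2"
              using u_diag[OF i] half(1) by linarith
          next
            fix i l assume il: "i < k" "l < k" "i \<noteq> l"
            have "pair i l \<in> W" using il by (auto simp: W_def)
            from good[OF elim(3) False this]
            have "\<bar>(\<Sum>j<J. (T j (u i) x + T j (u l) x)\<^sup>2) / real J - sqnorm M (pair i l)\<bar> < \<theta>"
              using elim(2) by simp
            then show "(\<Sum>j<J. (T j (u i) x + T j (u l) x)\<^sup>2) / real J \<le> 2 + 1 / L\<^sup>2"
              using u_off[OF il] half(2) unfolding pair_def by linarith
          qed
          then show ?thesis using False elim(3) by (simp add: V_def r_def c0_def)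
        qed
      qed
    qed
    also have "\<dots> = sign_avg J (\<lambda>e. \<integral>x. of_bool (\<exists>i<k. L / 4 \<le> V i e x) \<partial>M)"
      by (intro sign_avg_integral(2) prob_eq_integral_of_bool(1) A_meas)
    also have "\<dots> = sign_avg J (\<lambda>e. prob (?A e))"
      by (simp only: prob_eq_integral_of_bool(2)[OF A_meas])
    finally show ?thesis .
  qed
  \<comment> \<open>A lower bound for the probability in question, reduced by a multiple of the norm of \<open>F\<close>: a sign
    pattern with large \<open>\<phi>\<close> has a large maximum and a controlled norm of \<open>F\<close> at the same time.\<close>
  define \<phi> where "\<phi> e = prob (?A e) - (16 * (real k * (C * sqnorm M (G e))) + 16 * (\<Sum>i<k. sqnorm M (R i e))
      + (c0 / 32) * sqnorm M (F e))" for e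
  have "sign_avg J (\<lambda>e. prob (?A e)) = sign_avg J \<phi> + (sign_avg J (\<lambda>e. 16 * (real k * (C * sqnorm M (G e)))) +
      sign_avg J (\<lambda>e. 16 * (\<Sum>i<k. sqnorm M (R i e))) + (c0 / 32) * sign_avg J (\<lambda>e. sqnorm M (F e)))"
    unfolding sign_avg_scale[symmetric, where c = "c0 / 32"] sign_avg_add[symmetric] by (simp add: \<phi>_def)
  moreover have "(c0 / 32) * sign_avg J (\<lambda>e. sqnorm M (F e)) \<le> (c0 / 32) * 1"
    using avgF c0 by (intro mult_left_mono) auto
  ultimately have "c0 / 4 \<le> sign_avg J \<phi>"
    using avgA avgG' avgR c0 by linarith
  then obtain e where e: "c0 / 4 \<le> \<phi> e" using sign_avg_attained by blast
  have nonneg: "0 \<le> 16 * (real k * (C * sqnorm M (G e)))" "0 \<le> 16 * (\<Sum>i<k. sqnorm M (R i e))"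
    "0 \<le> (c0 / 32) * sqnorm M (F e)"
    using C c0 by (auto intro!: mult_nonneg_nonneg sum_nonneg)
  show ?thesis
  proof (intro bexI[of _ "g e"] conjI allI)
    show "max_prob / 4 \<le> prob (?P e)"
      using e split[of e] nonneg unfolding \<phi>_def c0_def by linarith
    have "(c0 / 32) * sqnorm M (F e) \<le> 1"
      using e nonneg c0 prob_le_1[of "?A e"] unfolding \<phi>_def by linarith
    then have "sqnorm M (F e) \<le> 32 / c0" using c0 by (simp add: field_simps)
    then have "sqnorm M (F e) / K\<^sup>2 \<le> (32 / c0) / K\<^sup>2" by (rule divide_right_mono) simp
    also have "\<dots> = 2 / (c0 * L\<^sup>2)" by (simp add: K_def power_mult_distrib)
    finally show "sqnorm M (g e) \<le> 2 / (max_prob * L\<^sup>2)"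
      using g2[of e] unfolding c0_def by linarith
  qed (auto simp: g1)
qed

end

section \<open>Separated orbits and entropy numbers\<close>

text \<open>
  For \<open>c a b\<close> the inner product of vectors \<open>v a\<close> and \<open>v b\<close>, the last expression is the inner product of
  \<open>v (p i) - v (q i)\<close> with \<open>v (p l) - v (q l)\<close>. Colour the pair of \<open>a\<close> and \<open>b\<close> by the interval of length
  \<open>\<tau>\<close> that contains \<open>c a b\<close>. On a monochromatic set of \<open>2 k\<close> indices, split into \<open>k\<close> disjoint pairs, the
  four terms cancel up to \<open>2 \<tau>\<close>.
\<close>

lemma ramsey_small_cross_differences:
  fixes k :: nat
  assumes \<tau>: "\<tau> > 0"
  shows "\<exists>N::nat. \<forall>c::nat \<Rightarrow> nat \<Rightarrow> real. (\<forall>a b. c a b = c b a) \<longrightarrow> (\<forall>a b. \<bar>c a b\<bar> \<le> 1) \<longrightarrow>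
    (\<exists>p q. (\<forall>i<k. p i < N \<and> q i < N \<and> p i \<noteq> q i) \<and>
      (\<forall>i<k. \<forall>l<k. i \<noteq> l \<longrightarrow> c (p i) (p l) - c (p i) (q l) - c (q i) (p l) + c (q i) (q l) \<le> 2 * \<tau>))"
proof -
  define Q where "Q = nat \<lfloor>2 / \<tau>\<rfloor> + 1"
  obtain N :: nat where N: "partn_lst {..<N} (replicate Q (2 * k)) 2"
    using ramsey_full by blast
  have "\<exists>p q. (\<forall>i<k. p i < N \<and> q i < N \<and> p i \<noteq> q i) \<and>
      (\<forall>i<k. \<forall>l<k. i \<noteq> l \<longrightarrow> c (p i) (p l) - c (p i) (q l) - c (q i) (p l) + c (q i) (q l) \<le> 2 * \<tau>)"
    if sym: "\<forall>a b. c a b = c b a" and bd: "\<forall>a b. \<bar>c a b\<bar> \<le> 1" for c :: "nat \<Rightarrow> nat \<Rightarrow> real"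
  proof -
    define col where "col e = nat \<lfloor>(c (Min e) (Max e) + 1) / \<tau>\<rfloor>" for e
    have range: "0 \<le> (c a b + 1) / \<tau>" "(c a b + 1) / \<tau> \<le> 2 / \<tau>" for a b
      using bd[rule_format, of a b] \<tau> by (auto intro!: divide_right_mono divide_nonneg_pos simp: abs_le_iff)
    have "col e < Q" for e
      using floor_mono[OF range(2), of "Min e" "Max e"] unfolding col_def Q_def by linarith
    then have "col \<in> nsets {..<N} 2 \<rightarrow> {..<Q}" by auto
    from partn_lstE[OF N this] obtain s H where s: "s < Q" and H: "H \<in> nsets {..<N} (2 * k)"
      and mono: "col ` nsets H 2 \<subseteq> {s}"
      by (metis length_replicate nth_replicate)
    have c_near: "real s * \<tau> - 1 \<le> c a b \<and> c a b \<le> real s * \<tau> + \<tau> - 1" if "a \<in> H" "b \<in> H" "a \<noteq> b" for a b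
    proof -
      have "{a, b} \<in> nsets H 2" using that by (simp add: nsets_def)
      then have "col {a, b} = s" using mono by blast
      moreover have "c (Min {a, b}) (Max {a, b}) = c a b"
        using sym by (simp add: min_def max_def)
      ultimately have "nat \<lfloor>(c a b + 1) / \<tau>\<rfloor> = s" by (simp add: col_def)
      then have "\<lfloor>(c a b + 1) / \<tau>\<rfloor> = int s" using range(1)[of a b] by auto
      then have "real s \<le> (c a b + 1) / \<tau>" "(c a b + 1) / \<tau> < real s + 1"
        by (simp_all add: floor_eq_iff)
      then show ?thesis using \<tau> by (simp add: pos_le_divide_eq pos_divide_less_eq algebra_simps)
    qed
    have fin: "finite H" "card H = 2 * k" "H \<subseteq> {..<N}" using H by (auto simp: nsets_def)
    obtain h where h: "bij_betw h {0..<2 * k} H"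
      using ex_bij_betw_nat_finite[OF fin(1)] fin(2) by auto
    have hH: "h a \<in> H" if "a < 2 * k" for a using bij_betwE[OF h] that by simp
    have hinj: "h a \<noteq> h b" if "a < 2 * k" "b < 2 * k" "a \<noteq> b" for a b
      using inj_on_eq_iff[OF bij_betw_imp_inj_on[OF h], of a b] that by simp
    show ?thesis
    proof (rule exI[of _ "\<lambda>i. h (2 * i)"], rule exI[of _ "\<lambda>i. h (2 * i + 1)"], intro conjI allI impI)
      fix i assume i: "i < k"
      show "h (2 * i) < N" "h (2 * i + 1) < N" using hH[of "2 * i"] hH[of "2 * i + 1"] i fin(3) by auto
      show "h (2 * i) \<noteq> h (2 * i + 1)" using i by (intro hinj) auto
    next
      fix i l assume il: "i < k" "l < k" "i \<noteq> l"
      have near: "real s * \<tau> - 1 \<le> c (h a) (h b) \<and> c (h a) (h b) \<le> real s * \<tau> + \<tau> - 1"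
        if "a < 2 * k" "b < 2 * k" "a \<noteq> b" for a b
        using that by (intro c_near hH hinj)
      have ne: "2 * i + 1 \<noteq> 2 * l" "2 * i \<noteq> 2 * l + 1" by presburger+
      show "c (h (2 * i)) (h (2 * l)) - c (h (2 * i)) (h (2 * l + 1)) - c (h (2 * i + 1)) (h (2 * l)) +
          c (h (2 * i + 1)) (h (2 * l + 1)) \<le> 2 * \<tau>"
        using near[of "2 * i" "2 * l"] near[of "2 * i" "2 * l + 1"] near[of "2 * i + 1" "2 * l"]
          near[of "2 * i + 1" "2 * l + 1"] il ne by auto
    qed
  qed
  then show ?thesis by blast
qed

text \<open>
  A separated set of maximal cardinality is the set of centres of a cover.
\<close>

lemma entropy_number_le_separated:
  fixes d :: "'b \<Rightarrow> 'b \<Rightarrow> real"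
  assumes sym: "\<And>y z. d y z = d z y" and refl: "\<And>y. d y y \<le> \<delta>"
    and sep: "\<And>n :: nat \<Rightarrow> 'b. \<exists>i<N. \<exists>j<N. i \<noteq> j \<and> d (n i) (n j) \<le> \<delta>"
  shows "entropy_number UNIV d \<delta> \<le> enat N"
proof -
  let ?P = "\<lambda>A. finite A \<and> (\<forall>y\<in>A. \<forall>z\<in>A. y \<noteq> z \<longrightarrow> \<delta> < d y z)"
  have small: "card A \<le> N" if A: "?P A" for A
  proof (rule ccontr)
    assume "\<not> card A \<le> N"
    from A have "finite A" by simp
    from ex_bij_betw_nat_finite[OF this] obtain h where h: "bij_betw h {0..<card A} A" by (rule exE)
    obtain i j where ij: "i < N" "j < N" "i \<noteq> j" "d (h i) (h j) \<le> \<delta>" using sep by blast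
    have "i < card A" "j < card A" using ij \<open>\<not> card A \<le> N\<close> by auto
    then have "h i \<in> A" "h j \<in> A" "h i \<noteq> h j"
      using bij_betwE[OF h] inj_on_eq_iff[OF bij_betw_imp_inj_on[OF h], of i j] ij(3) by simp_all
    then have "\<delta> < d (h i) (h j)" using A by blast
    then show False using ij(4) by simp
  qed
  have "?P {}" by simp
  moreover have "\<forall>A. ?P A \<longrightarrow> card A < Suc N" using small by (simp add: less_Suc_eq_le)
  ultimately have "\<exists>A. ?P A \<and> (\<forall>B. ?P B \<longrightarrow> card B \<le> card A)"
    by (rule Lattices_Big.ex_has_greatest_nat)
  then obtain A where A_max: "?P A \<and> (\<forall>B. ?P B \<longrightarrow> card B \<le> card A)" by (rule exE)
  then have A: "?P A" by (rule conjunct1)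
  have max: "card B \<le> card A" if "?P B" for B
    by (rule mp[OF spec[OF conjunct2[OF A_max], of B] that])
  have "\<exists>y\<in>A. d y z \<le> \<delta>" for z
  proof (rule ccontr)
    assume far: "\<not> ?thesis"
    then have "z \<notin> A" using refl by blast
    moreover have "?P (insert z A)"
    proof (intro conjI ballI impI)
      fix y y' assume yy: "y \<in> insert z A" "y' \<in> insert z A" "y \<noteq> y'"
      show "\<delta> < d y y'"
      proof (cases "y = z")
        case True
        then have "\<not> d y' z \<le> \<delta>" using yy far by blast
        then show ?thesis using True sym[of z y'] by simp
      next
        case False
        then show ?thesis using yy far A by (cases "y' = z") (auto simp: not_le)
      qed
    qed (use A in simp)
    ultimately show False using max[of "insert z A"] A by simp
  qed
  then have "entropy_number UNIV d \<delta> \<le> enat (card A)"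
    unfolding entropy_number_def
  proof (intro Inf_lower CollectI exI conjI)
    show "UNIV \<subseteq> (\<Union>y\<in>A. {z. d y z \<le> \<delta>})"
      using \<open>\<And>z. \<exists>y\<in>A. d y z \<le> \<delta>\<close> by auto
    show "finite A" using A by (rule conjunct1)
  qed simp
  also have "\<dots> \<le> enat N" using small[OF A] by simp
  finally show ?thesis .
qed

context prob_space
begin

lemma inner_product_le_one:
  assumes "v \<in> L2_space M" "w \<in> L2_space M" "sqnorm M v \<le> 1" "sqnorm M w \<le> 1"
  shows "\<bar>\<integral>x. v x * w x \<partial>M\<bar> \<le> 1"
proof -
  let ?c = "\<integral>x. v x * w x \<partial>M"
  have "sqnorm M (\<lambda>x. v x + (-1) * w x) = sqnorm M v + sqnorm M w - 2 * ?c"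
    using sqnorm_add_expand[OF assms(1) L2_space_scale[OF assms(2), of "-1"]] by simp
  moreover have "0 \<le> sqnorm M (\<lambda>x. v x + w x)" "0 \<le> sqnorm M (\<lambda>x. v x + (-1) * w x)"
    by (rule sqnorm_nonneg)+
  ultimately show ?thesis
    using sqnorm_add_expand[OF assms(1,2)] assms(3,4) by linarith
qed

text \<open>
  The order of choices: \<open>\<epsilon>\<close> from \<open>\<delta>\<close>, then \<open>\<eta>\<close> from the maximal inequality, then the number \<open>k\<close> of
  pairs so large that \<open>near_orthonormal_images_large_maximum\<close> yields \<open>g\<close> with squared norm at most \<open>\<eta>\<close>,
  and finally \<open>N\<close> from Ramsey's theorem. None of them depends on \<open>f\<close>.
\<close>

lemma bounded_orbit_not_separated:
  fixes S T :: "nat \<Rightarrow> ('a \<Rightarrow> real) \<Rightarrow> 'a \<Rightarrow> real"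
  assumes lin: "\<And>n. linear_operator M (S n)" and con: "\<And>n. L2_contraction M (S n)"
    and T: "bourgain_sequence M T"
    and comm: "\<And>n j. commuting_operators M (S n) (T j)"
    and conv: "\<forall>f\<in>borel_measurable M. (\<forall>x. \<bar>f x\<bar> \<le> 1) \<longrightarrow> (AE x in M. convergent (\<lambda>n. S n f x))"
    and \<delta>: "\<delta> > 0"
  shows "\<exists>N::nat. \<forall>f\<in>borel_measurable M. (\<exists>B. \<forall>x. \<bar>f x\<bar> \<le> B) \<longrightarrow> sqnorm M f \<le> 1 \<longrightarrow>
    (\<forall>n :: nat \<Rightarrow> nat. \<exists>i<N. \<exists>j<N. i \<noteq> j \<and> sqnorm M (\<lambda>x. S (n i) f x - S (n j) f x) \<le> \<delta>\<^sup>2)"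
proof -
  define c0 where "c0 = max_prob"
  have c0: "0 < c0" by (simp add: c0_def)
  \<comment> \<open>If \<open>U i g\<close> reaches \<open>1 / 32\<close>, one of two values \<open>S n g\<close> reaches \<open>\<delta> / 64\<close>, with probability at
    least \<open>c0 / 4\<close>. Both numbers have to exceed \<open>\<epsilon>\<close>.\<close>
  define \<epsilon> where "\<epsilon> = min (\<delta> / 128) (c0 / 8)"
  have \<epsilon>: "\<epsilon> > 0" "\<epsilon> \<le> \<delta> / 128" "\<epsilon> \<le> c0 / 8" using \<delta> c0 by (auto simp: \<epsilon>_def)
  obtain \<eta> where \<eta>: "\<eta> > 0" and small: "\<And>g m. g \<in> borel_measurable M \<Longrightarrow> (\<And>x. \<bar>g x\<bar> \<le> 1) \<Longrightarrow>
      sqnorm M g \<le> \<eta> \<Longrightarrow> prob {x\<in>space M. \<exists>n\<le>m. \<bar>S n g x\<bar> > \<epsilon>} \<le> \<epsilon>"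
    using maximal_function_small[OF lin con conv \<epsilon>(1)] by blast
  define C where "C = 4 / \<delta>\<^sup>2"
  have C: "C \<ge> 0" by (simp add: C_def)
  define k where "k = nat \<lceil>max (exp (max 16 (2 / (c0 * \<eta>)))) (2560 * C / c0)\<rceil>"
  have "max (exp (max 16 (2 / (c0 * \<eta>)))) (2560 * C / c0) \<le> real k"
    unfolding k_def by linarith
  then have k: "exp (max 16 (2 / (c0 * \<eta>))) \<le> real k" "2560 * C / c0 \<le> real k" by simp_all
  have k0: "real k > 0" using k(1) exp_gt_zero less_le_trans by blast
  have lnk: "max 16 (2 / (c0 * \<eta>)) \<le> ln (real k)" using k(1) k0 by (simp only: ln_ge_iff)
  define L where "L = sqrt (ln (real k))"
  have Lsq: "L\<^sup>2 = ln (real k)" using lnk by (simp add: L_def)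
  have L: "L \<ge> 4" unfolding L_def by (rule real_le_rsqrt) (use lnk in simp)
  have kL: "real k = exp (L\<^sup>2)" using k0 by (simp add: Lsq)
  have kC: "2560 * C \<le> max_prob * real k"
    using k(2) c0 unfolding c0_def[symmetric] by (simp add: field_simps)
  define \<rho> where "\<rho> = 1 / (8 * L\<^sup>2)"
  have \<rho>: "\<rho> > 0" using L by (simp add: \<rho>_def)
  define \<tau> where "\<tau> = \<rho> * \<delta>\<^sup>2 / 2"
  have \<tau>: "\<tau> > 0" using \<rho> \<delta> by (simp add: \<tau>_def)
  obtain N :: nat where N: "\<forall>c::nat \<Rightarrow> nat \<Rightarrow> real. (\<forall>a b. c a b = c b a) \<longrightarrow> (\<forall>a b. \<bar>c a b\<bar> \<le> 1) \<longrightarrow>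
    (\<exists>p q. (\<forall>i<k. p i < N \<and> q i < N \<and> p i \<noteq> q i) \<and>
      (\<forall>i<k. \<forall>l<k. i \<noteq> l \<longrightarrow> c (p i) (p l) - c (p i) (q l) - c (q i) (p l) + c (q i) (q l) \<le> 2 * \<tau>))"
    using ramsey_small_cross_differences[OF \<tau>, of k] by (rule exE)
  have "\<exists>i<N. \<exists>j<N. i \<noteq> j \<and> sqnorm M (\<lambda>x. S (n i) f x - S (n j) f x) \<le> \<delta>\<^sup>2"
    if f: "f \<in> borel_measurable M" "\<And>x. \<bar>f x\<bar> \<le> B" "sqnorm M f \<le> 1" for f B and n :: "nat \<Rightarrow> nat"
  proof (rule ccontr)
    assume "\<not> ?thesis"
    then have sep: "\<delta>\<^sup>2 < sqnorm M (\<lambda>x. S (n i) f x - S (n j) f x)" if "i < N" "j < N" "i \<noteq> j" for i j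
      using that by (meson not_le)
    have fL: "f \<in> L2_space M" by (rule bounded_in_L2_space[OF f(1,2)])
    define v where "v i = S (n i) f" for i
    have v: "v i \<in> L2_space M" "sqnorm M (v i) \<le> 1" for i
      using L2_contraction_sqnorm[OF con[of "n i"] fL] f(3) by (auto simp: v_def)
    define c where "c i j = (\<integral>x. v i x * v j x \<partial>M)" for i j
    have c_sym: "c i j = c j i" for i j by (simp add: c_def mult.commute)
    have c_le: "\<bar>c i j\<bar> \<le> 1" for i j
      unfolding c_def by (rule inner_product_le_one[OF v(1) v(1) v(2) v(2)])
    have "\<exists>p q. (\<forall>i<k. p i < N \<and> q i < N \<and> p i \<noteq> q i) \<and>
        (\<forall>i<k. \<forall>l<k. i \<noteq> l \<longrightarrow> c (p i) (p l) - c (p i) (q l) - c (q i) (p l) + c (q i) (q l) \<le> 2 * \<tau>)"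
      by (rule mp[OF mp[OF spec[OF N, of c]]]) (intro allI c_sym c_le)+
    then obtain p q where pq': "(\<forall>i<k. p i < N \<and> q i < N \<and> p i \<noteq> q i) \<and>
        (\<forall>i<k. \<forall>l<k. i \<noteq> l \<longrightarrow> c (p i) (p l) - c (p i) (q l) - c (q i) (p l) + c (q i) (q l) \<le> 2 * \<tau>)"
      by (elim exE)
    then have pq: "p i < N \<and> q i < N \<and> p i \<noteq> q i" if "i < k" for i
      using that by simp
    have cross: "c (p i) (p l) - c (p i) (q l) - c (q i) (p l) + c (q i) (q l) \<le> 2 * \<tau>"
      if "i < k" "l < k" "i \<noteq> l" for i l
      using conjunct2[OF pq'] that by simp
    define D where "D i x = v (p i) x - v (q i) x" for i x
    have D: "D i \<in> L2_space M" for i unfolding D_def by (rule L2_space_diff[OF v(1) v(1)])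
    \<comment> \<open>For \<open>i < k\<close> the maximum is the norm of \<open>D i\<close>, by separation. For the other indices it keeps
      \<open>U i\<close> bounded by the same constant.\<close>
    define \<sigma> where "\<sigma> i = max \<delta> (sqrt (sqnorm M (D i)))" for i
    have \<sigma>: "\<sigma> i \<ge> \<delta>" "\<sigma> i > 0" for i using \<delta> by (auto simp: \<sigma>_def)
    have \<sigma>sq: "(\<sigma> i)\<^sup>2 = sqnorm M (D i)" if "i < k" for i
    proof -
      have "\<delta>\<^sup>2 < sqnorm M (D i)" using sep pq[OF that] by (simp add: D_def v_def)
      then have "\<delta> \<le> sqrt (sqnorm M (D i))" by (intro real_le_rsqrt) simp
      then show ?thesis by (simp add: \<sigma>_def max_absorb2)
    qed
    define U where "U i g x = (1 / \<sigma> i) * (S (n (p i)) g x - S (n (q i)) g x)" for i g x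
    have Ulin: "linear_operator M (U i)" for i
      unfolding linear_operator_def
    proof (intro conjI ballI allI)
      fix g :: "'a \<Rightarrow> real" assume g: "g \<in> borel_measurable M"
      note [measurable] = linear_operator_measurable[OF lin g]
      show "U i g \<in> borel_measurable M" unfolding U_def by measurable
    next
      fix g h :: "'a \<Rightarrow> real" assume g: "g \<in> borel_measurable M" and h: "h \<in> borel_measurable M"
      show "AE x in M. U i (\<lambda>y. g y + h y) x = U i g x + U i h x"
        using linear_operator_add[OF lin g h, of "n (p i)"] linear_operator_add[OF lin g h, of "n (q i)"]
        by eventually_elim (simp add: U_def algebra_simps add_divide_distrib diff_divide_distrib)
    next
      fix a :: real and g :: "'a \<Rightarrow> real" assume g: "g \<in> borel_measurable M"
      show "AE x in M. U i (\<lambda>y. a * g y) x = a * U i g x"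
        using linear_operator_scale[OF lin g, of "n (p i)" a] linear_operator_scale[OF lin g, of "n (q i)" a]
        by eventually_elim (simp add: U_def algebra_simps)
    qed
    have Ubd: "U i g \<in> L2_space M \<and> sqnorm M (U i g) \<le> C * sqnorm M g" if g: "g \<in> L2_space M" for i g
    proof
      note Sg = L2_contraction_sqnorm[OF con g]
      show "U i g \<in> L2_space M"
        unfolding U_def by (rule L2_space_scale[OF L2_space_diff[OF Sg(1) Sg(1)]])
      have "sqnorm M (U i g) = (1 / \<sigma> i)\<^sup>2 * sqnorm M (\<lambda>x. S (n (p i)) g x - S (n (q i)) g x)"
        unfolding U_def by (rule sqnorm_scale)
      also have "\<dots> \<le> (1 / \<delta>)\<^sup>2 * (4 * sqnorm M g)"
      proof (rule mult_mono)
        show "(1 / \<sigma> i)\<^sup>2 \<le> (1 / \<delta>)\<^sup>2"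
          using \<sigma>[of i] \<delta> by (intro power_mono divide_left_mono) auto
        show "sqnorm M (\<lambda>x. S (n (p i)) g x - S (n (q i)) g x) \<le> 4 * sqnorm M g"
          using sqnorm_diff_le[OF Sg(1) Sg(1), of "n (p i)" "n (q i)"] Sg(2)[of "n (p i)"] Sg(2)[of "n (q i)"]
          by linarith
      qed auto
      also have "\<dots> = C * sqnorm M g" by (simp add: C_def power_divide)
      finally show "sqnorm M (U i g) \<le> C * sqnorm M g" .
    qed
    have Ucomm: "commuting_operators M (U i) (T j)" for i j
      unfolding commuting_operators_def
    proof
      fix g :: "'a \<Rightarrow> real" assume g: "g \<in> borel_measurable M"
      have Tlin: "linear_operator M (T j)" using T by (simp add: bourgain_sequence_def)
      note Sg = linear_operator_measurable[OF lin g]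
      have "AE x in M. S (n (p i)) (T j g) x = T j (S (n (p i)) g) x"
        "AE x in M. S (n (q i)) (T j g) x = T j (S (n (q i)) g) x"
        using comm g by (auto simp: commuting_operators_def)
      moreover have "AE x in M. T j (\<lambda>y. S (n (p i)) g y - S (n (q i)) g y) x =
          T j (S (n (p i)) g) x - T j (S (n (q i)) g) x"
        by (rule linear_operator_diff[OF Tlin Sg Sg])
      moreover have "AE x in M. T j (\<lambda>y. (1 / \<sigma> i) * (S (n (p i)) g y - S (n (q i)) g y)) x =
          (1 / \<sigma> i) * T j (\<lambda>y. S (n (p i)) g y - S (n (q i)) g y) x"
        using Sg by (intro linear_operator_scale[OF Tlin]) simp
      ultimately show "AE x in M. U i (T j g) x = T j (U i g) x"
        unfolding U_def by eventually_elim simp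
    qed
    have Uf: "U i f = (\<lambda>x. (1 / \<sigma> i) * D i x)" for i
      by (simp add: U_def D_def v_def fun_eq_iff)
    have norm: "sqnorm M (U i f) = 1" if "i < k" for i
    proof -
      have "sqnorm M (U i f) = (1 / \<sigma> i)\<^sup>2 * (\<sigma> i)\<^sup>2"
        unfolding Uf \<sigma>sq[OF that] by (rule sqnorm_scale)
      then show ?thesis using \<sigma>(2)[of i] by (simp add: power_divide)
    qed
    have off: "(\<integral>x. U i f x * U l f x \<partial>M) \<le> 1 / (8 * L\<^sup>2)" if il: "i < k" "l < k" "i \<noteq> l" for i l
    proof -
      note I = L2_space_mult_integrable[OF v(1) v(1)]
      have "(\<integral>x. U i f x * U l f x \<partial>M) = (\<integral>x. (1 / (\<sigma> i * \<sigma> l)) * (D i x * D l x) \<partial>M)"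
        by (simp add: Uf mult_ac)
      also have "\<dots> = (1 / (\<sigma> i * \<sigma> l)) * (\<integral>x. D i x * D l x \<partial>M)"
        by (rule integral_mult_right_zero)
      also have "(\<integral>x. D i x * D l x \<partial>M) = (\<integral>x. ((v (p i) x * v (p l) x - v (p i) x * v (q l) x)
          - v (q i) x * v (p l) x) + v (q i) x * v (q l) x \<partial>M)"
        by (simp add: D_def algebra_simps)
      also have "\<dots> = c (p i) (p l) - c (p i) (q l) - c (q i) (p l) + c (q i) (q l)"
        unfolding c_def using I by (simp add: Bochner_Integration.integral_add Bochner_Integration.integral_diff)
      also have "(1 / (\<sigma> i * \<sigma> l)) * \<dots> \<le> (1 / (\<sigma> i * \<sigma> l)) * (2 * \<tau>)"
        using \<sigma>(2)[of i] \<sigma>(2)[of l] by (intro mult_left_mono cross il) simp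
      also have "\<dots> \<le> (1 / (\<delta> * \<delta>)) * (2 * \<tau>)"
        using \<sigma>[of i] \<sigma>[of l] \<delta> \<tau> by (intro mult_right_mono divide_left_mono mult_mono) auto
      also have "\<dots> = 1 / (8 * L\<^sup>2)"
        using \<delta> by (simp add: \<tau>_def \<rho>_def power2_eq_square)
      finally show ?thesis .
    qed
    have "\<exists>g\<in>borel_measurable M. (\<forall>x. \<bar>g x\<bar> \<le> 1) \<and> sqnorm M g \<le> 2 / (max_prob * L\<^sup>2) \<and>
        max_prob / 4 \<le> prob {x\<in>space M. \<exists>i<k. \<bar>U i g x\<bar> \<ge> 1/32}"
      by (rule near_orthonormal_images_large_maximum[OF T Ulin _ Ucomm f kL kC C L]) (fact Ubd norm off)+
    then obtain g where g: "g \<in> borel_measurable M" "\<And>x. \<bar>g x\<bar> \<le> 1" "sqnorm M g \<le> 2 / (max_prob * L\<^sup>2)"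
      "max_prob / 4 \<le> prob {x\<in>space M. \<exists>i<k. \<bar>U i g x\<bar> \<ge> 1/32}"
      by blast
    define m where "m = Max ((\<lambda>i. n (p i)) ` {..<k} \<union> (\<lambda>i. n (q i)) ` {..<k})"
    have m: "n (p i) \<le> m" "n (q i) \<le> m" if "i < k" for i
      unfolding m_def using that by (auto intro!: Max_ge)
    have "sqnorm M g \<le> \<eta>"
    proof -
      have "2 / (c0 * \<eta>) \<le> L\<^sup>2" using lnk by (simp add: Lsq)
      then have "2 / (c0 * L\<^sup>2) \<le> \<eta>" using c0 \<eta> L by (simp add: field_simps)
      then show ?thesis using g(3) by (simp only: c0_def)
    qed
    then have "prob {x\<in>space M. \<exists>n\<le>m. \<bar>S n g x\<bar> > \<epsilon>} \<le> \<epsilon>"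
      by (rule small[OF g(1,2)])
    moreover have "prob {x\<in>space M. \<exists>i<k. \<bar>U i g x\<bar> \<ge> 1/32} \<le> prob {x\<in>space M. \<exists>n\<le>m. \<bar>S n g x\<bar> > \<epsilon>}"
    proof (rule finite_measure_mono)
      show "{x\<in>space M. \<exists>i<k. \<bar>U i g x\<bar> \<ge> 1/32} \<subseteq> {x\<in>space M. \<exists>n\<le>m. \<bar>S n g x\<bar> > \<epsilon>}"
      proof safe
        fix x i assume x: "i < k" "1 / 32 \<le> \<bar>U i g x\<bar>"
        have "\<delta> * (1 / 32) \<le> \<sigma> i * \<bar>U i g x\<bar>"
          using x \<sigma>[of i] \<delta> by (intro mult_mono) auto
        also have "\<dots> = \<bar>S (n (p i)) g x - S (n (q i)) g x\<bar>"
          using \<sigma>(2)[of i] by (simp add: U_def abs_mult)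
        finally have "\<epsilon> < \<bar>S (n (p i)) g x\<bar> \<or> \<epsilon> < \<bar>S (n (q i)) g x\<bar>"
          using \<epsilon>(2) \<delta> by linarith
        then show "\<exists>n\<le>m. \<bar>S n g x\<bar> > \<epsilon>" using m[OF x(1)] by blast
      qed
      note [measurable] = linear_operator_measurable[OF lin g(1)]
      show "{x\<in>space M. \<exists>n\<le>m. \<bar>S n g x\<bar> > \<epsilon>} \<in> events" by measurable
    qed
    ultimately have "c0 / 4 \<le> c0 / 8" using g(4) \<epsilon>(3) unfolding c0_def by linarith
    then show False using c0 by simp
  qed
  then show ?thesis by blast
qed

text \<open>
  For a contraction, replacing \<open>f\<close> by a truncation moves all \<open>S n f\<close> simultaneously by at most the norm
  of the difference.
\<close>

lemma orbit_not_separated: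
  fixes S T :: "nat \<Rightarrow> ('a \<Rightarrow> real) \<Rightarrow> 'a \<Rightarrow> real"
  assumes lin: "\<And>n. linear_operator M (S n)" and con: "\<And>n. L2_contraction M (S n)"
    and T: "bourgain_sequence M T"
    and comm: "\<And>n j. commuting_operators M (S n) (T j)"
    and conv: "\<forall>f\<in>borel_measurable M. (\<forall>x. \<bar>f x\<bar> \<le> 1) \<longrightarrow> (AE x in M. convergent (\<lambda>n. S n f x))"
    and \<delta>: "\<delta> > 0"
  shows "\<exists>N::nat. \<forall>f\<in>L2_space M. sqnorm M f \<le> 1 \<longrightarrow>
    (\<forall>n :: nat \<Rightarrow> nat. \<exists>i<N. \<exists>j<N. i \<noteq> j \<and> sqnorm M (\<lambda>x. S (n i) f x - S (n j) f x) \<le> \<delta>\<^sup>2)"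
proof -
  obtain N :: nat where N: "\<And>f n. f \<in> borel_measurable M \<Longrightarrow> \<exists>B. \<forall>x. \<bar>f x\<bar> \<le> B \<Longrightarrow> sqnorm M f \<le> 1 \<Longrightarrow>
    \<exists>i<N. \<exists>j<N. i \<noteq> j \<and> sqnorm M (\<lambda>x. S (n i) f x - S (n j) f x) \<le> (\<delta> / 2)\<^sup>2"
    using bounded_orbit_not_separated[OF lin con T comm conv half_gt_zero[OF \<delta>]] by blast
  \<comment> \<open>With the remainder \<open>t\<close> below the level \<open>\<delta>\<^sup>2 / 16\<close>, two indices that are \<open>\<delta> / 2\<close> close for the
    truncation are \<open>\<delta>\<close> close for \<open>f\<close>.\<close>
  have "\<exists>i<N. \<exists>j<N. i \<noteq> j \<and> sqnorm M (\<lambda>x. S (n i) f x - S (n j) f x) \<le> \<delta>\<^sup>2"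
    if f: "f \<in> L2_space M" "sqnorm M f \<le> 1" for f and n :: "nat \<Rightarrow> nat"
  proof -
    have "\<forall>\<^sub>F m in sequentially. sqnorm M (\<lambda>x. f x - clip (real m) (f x)) < \<delta>\<^sup>2 / 16"
      using \<delta> by (intro order_tendstoD[OF sqnorm_clip_diff_tendsto[OF f(1)]]) simp
    then obtain m :: nat where m: "sqnorm M (\<lambda>x. f x - clip (real m) (f x)) < \<delta>\<^sup>2 / 16"
      using eventually_happens'[OF sequentially_bot] by blast
    define b where "b x = clip (real m) (f x)" for x
    define t where "t x = f x - b x" for x
    have b: "b \<in> L2_space M" "sqnorm M b \<le> 1" "\<bar>b x\<bar> \<le> real m" for x
      using sqnorm_clip_le[OF f(1), of "real m"] f(2) by (simp_all add: b_def[abs_def] abs_clip_le)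
    have t: "t \<in> L2_space M" unfolding t_def by (rule L2_space_diff[OF f(1) b(1)])
    obtain i j where ij: "i < N" "j < N" "i \<noteq> j"
      and close: "sqnorm M (\<lambda>x. S (n i) b x - S (n j) b x) \<le> (\<delta> / 2)\<^sup>2"
      using N[OF L2_space_measurable[OF b(1)] _ b(2), of n] b(3) by blast
    let ?A = "\<lambda>x. S (n i) b x - S (n j) b x" and ?R = "\<lambda>x. S (n i) t x - S (n j) t x"
    note Sb = L2_contraction_sqnorm[OF con b(1)] and St = L2_contraction_sqnorm[OF con t]
      and Sf = L2_contraction_sqnorm[OF con f(1)]
    have AR: "?A \<in> L2_space M" "?R \<in> L2_space M"
      by (intro L2_space_diff Sb St)+
    have "AE x in M. \<forall>k. S k t x = S k f x - S k b x"
      unfolding AE_all_countable t_def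
      by (intro allI linear_operator_diff[OF lin] L2_space_measurable f b)
    then have "AE x in M. (S (n i) f x - S (n j) f x)\<^sup>2 = (?A x + ?R x)\<^sup>2"
      by eventually_elim simp
    then have "sqnorm M (\<lambda>x. S (n i) f x - S (n j) f x) = sqnorm M (\<lambda>x. ?A x + ?R x)"
      by (rule integral_cong_AE[rotated 2])
        (use L2_space_measurable[OF L2_space_diff[OF Sf(1) Sf(1)]] L2_space_measurable[OF L2_space_add[OF AR]] in auto)
    also have "\<dots> \<le> 2 * sqnorm M ?A + 2 * sqnorm M ?R" by (rule sqnorm_add_le[OF AR])
    also have "sqnorm M ?R \<le> 4 * sqnorm M t"
      using sqnorm_diff_le[OF St(1) St(1), of "n i" "n j"] St(2)[of "n i"] St(2)[of "n j"] by linarith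
    also have "sqnorm M t \<le> \<delta>\<^sup>2 / 16" using m by (simp add: t_def b_def)
    finally have "sqnorm M (\<lambda>x. S (n i) f x - S (n j) f x) \<le> 2 * (\<delta> / 2)\<^sup>2 + 2 * (4 * (\<delta>\<^sup>2 / 16))"
      using close by linarith
    also have "\<dots> = \<delta>\<^sup>2" by (simp add: power_divide)
    finally show ?thesis using ij by blast
  qed
  then show ?thesis by blast
qed

end

theorem proposition2:
  fixes M :: "'a measure"
    and S T :: "nat \<Rightarrow> ('a \<Rightarrow> real) \<Rightarrow> 'a \<Rightarrow> real"
  assumes "prob_space M"
    and "\<And>n. linear_operator M (S n)"
    and "\<And>n. L2_contraction M (S n)"
    and "bourgain_sequence M T"
    and "\<And>n j. commuting_operators M (S n) (T j)"
    and "\<And>f. f \<in> Linfty_space M \<Longrightarrow> AE x in M. convergent (\<lambda>n. S n f x)"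
  shows "\<exists>C :: real \<Rightarrow> nat. \<forall>\<delta>>0. \<forall>f \<in> L2_space M.
           L2_norm M f \<le> 1 \<longrightarrow> orbit_entropy M S f \<delta> \<le> enat (C \<delta>)"
proof -
  interpret prob_space M by fact
  have conv: "\<forall>f\<in>borel_measurable M. (\<forall>x. \<bar>f x\<bar> \<le> 1) \<longrightarrow> (AE x in M. convergent (\<lambda>n. S n f x))"
  proof (intro ballI impI assms(6))
    fix f :: "'a \<Rightarrow> real" assume f: "f \<in> borel_measurable M" "\<forall>x. \<bar>f x\<bar> \<le> 1"
    have "esssup M (\<lambda>x. ereal \<bar>f x\<bar>) \<le> ereal 1"
      using f by (intro esssup_I) auto
    then have "esssup M (\<lambda>x. ereal \<bar>f x\<bar>) < \<infinity>"
      by (rule le_less_trans) simp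
    then show "f \<in> Linfty_space M" using f(1) by (simp add: Linfty_space_def)
  qed
  have "\<exists>N. \<forall>f\<in>L2_space M. L2_norm M f \<le> 1 \<longrightarrow> orbit_entropy M S f \<delta> \<le> enat N" if \<delta>: "\<delta> > 0" for \<delta>
  proof -
    obtain N :: nat where N: "\<And>f n. f \<in> L2_space M \<Longrightarrow> sqnorm M f \<le> 1 \<Longrightarrow>
        \<exists>i<N. \<exists>j<N. i \<noteq> j \<and> sqnorm M (\<lambda>x. S (n i) f x - S (n j) f x) \<le> \<delta>\<^sup>2"
      using orbit_not_separated[OF assms(2-5) conv \<delta>] by blast
    have "orbit_entropy M S f \<delta> \<le> enat N" if f: "f \<in> L2_space M" "L2_norm M f \<le> 1" for f
      unfolding orbit_entropy_def
    proof (rule entropy_number_le_separated)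
      show "orbit_dist M S f y z = orbit_dist M S f z y" for y z
        by (simp add: orbit_dist_def L2_norm_def power2_commute)
      show "orbit_dist M S f y y \<le> \<delta>" for y
        using \<delta> by (simp add: orbit_dist_def L2_norm_def)
      fix n :: "nat \<Rightarrow> nat"
      have "sqnorm M f \<le> 1" using f(2) by (simp add: L2_norm_def)
      from N[OF f(1) this, of n] obtain i j where ij: "i < N" "j < N" "i \<noteq> j"
        "sqnorm M (\<lambda>x. S (n i) f x - S (n j) f x) \<le> \<delta>\<^sup>2" by blast
      then have "orbit_dist M S f (n i) (n j) \<le> \<delta>"
        unfolding orbit_dist_def L2_norm_def using \<delta> by (intro real_le_lsqrt) auto
      with ij show "\<exists>i<N. \<exists>j<N. i \<noteq> j \<and> orbit_dist M S f (n i) (n j) \<le> \<delta>" by blast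
    qed
    then show ?thesis by blast
  qed
  then show ?thesis by metis
qed

end
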